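(* For $y=\bar y\,t_{-\lambda}\in\widetilde{\mathcal W}^{(+)}$ (with $\bar y\in\overline W$, $\lambda\in P$), the dimension $D_y=\sum_{z\in\widetilde W}m^y_z$ is given by $$D_y=9\prod_{\alpha>0}\Big\langle\bar y(\lambda)+\frac{\bar\rho}{3},\,\bar y(\alpha)\Big\rangle+\frac{\det(\bar y)}{3}=\frac13\prod_{\alpha>0}\langle\iota(y)+\bar\rho,\alpha\rangle+\frac{\det(\bar y)}{3}=\frac23\,\overline D_{\iota(y)}+\frac{\det(\bar y)}{3},$$ where the products are over the three positive roots of $sl(3)$ and $\overline D_{\mu}$ is the dimension of the irreducible finite-dimensional $sl(3)$-module of highest weight $\mu$.
   Context: Setting: $sl(3)$ with simple roots $\alpha_1,\alpha_2$, $\theta=\alpha_1+\alpha_2$, $\langle\alpha_i,\alpha_i\rangle=2$, root lattice $Q$, weight lattice $P$, fundamental weights $\bar\Lambda_1,\bar\Lambda_2$, $\bar\rho=\bar\Lambda_1+\bar\Lambda_2$, dominant weights $P_+$. $\overline W$ is the finite Weyl group, $\det(w)=\pm1$, shifted action $w\cdot\lambda=w(\lambda+\bar\rho)-\bar\rho$. The extended affine Weyl group is $\widetilde W=\overline W\ltimes t_P$ (with $w\,t_\beta w^{-1}=t_{w(\beta)}$), the affine Weyl group is $W=\overline W\ltimes t_Q$. Each $y\in\widetilde W$ is uniquely $y=\bar y\,t_{-\lambda}$, $\bar y\in\overline W$, $\lambda\in P$. $\iota:\widetilde W\to Q$, $\iota(\bar y\,t_{-\lambda})=3\lambda+\bar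 y^{-1}\cdot0$. $\widetilde{\mathcal W}^{(+)}=\{\bar y\,t_{-\lambda}\in\widetilde W:\lambda\in P_+,\ \langle\lambda,\alpha_i\rangle>0 \text{ whenever } \bar y(\alpha_i)\text{ is a negative root},\ i=1,2\}$; for $y\in\widetilde{\mathcal W}^{(+)}$ one has $\iota(y)\in P_+$. For $y\in\widetilde{\mathcal W}^{(+)}$ and $z\in\widetilde W$ the generalised weight multiplicity is $m^y_z=\bar m^{\iota(y)}_{\iota(z)}$ if $z\in Wy$ and $m^y_z=0$ otherwise, where $\bar m^\lambda_\mu$ is the multiplicity of the weight $\mu$ in the irreducible $sl(3)$-module of highest weight $\lambda\in P_+$. *)

theory Defs
  imports "HOL-Analysis.Analysis" "HOL-Library.Function_Algebras" "HOL-Algebra.Coset"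
begin

section \<open>Roots, weights and the finite Weyl group of sl(3)\<close>

text \<open>The dual of the Cartan subalgebra is realised as the plane of vectors with coordinate sum 0
  in real 3-space; the coordinate functions are the diagonal entries of a diagonal matrix, and
  the invariant form is the standard inner product.\<close>

definition \<alpha>1 :: "real^3" where "\<alpha>1 = vector [1, -1, 0]"
definition \<alpha>2 :: "real^3" where "\<alpha>2 = vector [0, 1, -1]"

definition simple_roots :: "(real^3) set" where "simple_roots = {\<alpha>1, \<alpha>2}"
definition pos_roots :: "(real^3) set" where "pos_roots = {\<alpha>1, \<alpha>2, \<alpha>1 + \<alpha>2}"
definition neg_roots :: "(real^3) set" where "neg_roots = uminus ` pos_roots"

definition \<Lambda>1 :: "real^3" where "\<Lambda>1 = vector [2/3, -1/3, -1/3]"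
definition \<Lambda>2 :: "real^3" where "\<Lambda>2 = vector [1/3, 1/3, -2/3]"
definition rho :: "real^3" where "rho = \<Lambda>1 + \<Lambda>2"

definition root_lattice :: "(real^3) set" where
  "root_lattice = {of_int a *\<^sub>R \<alpha>1 + of_int b *\<^sub>R \<alpha>2 | a b. True}"
definition weight_lattice :: "(real^3) set" where
  "weight_lattice = {of_int a *\<^sub>R \<Lambda>1 + of_int b *\<^sub>R \<Lambda>2 | a b. True}"
definition dominant_weights :: "(real^3) set" where
  "dominant_weights = {lam \<in> weight_lattice. \<forall>\<alpha>\<in>simple_roots. lam \<bullet> \<alpha> \<ge> 0}"

definition root_reflection :: "real^3 \<Rightarrow> real^3 \<Rightarrow> real^3" where
  "root_reflection \<alpha> x = x - (2 * (x \<bullet> \<alpha>) / (\<alpha> \<bullet> \<alpha>)) *\<^sub>R \<alpha>"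

inductive_set finite_weyl :: "(real^3 \<Rightarrow> real^3) set" where
  id: "id \<in> finite_weyl"
| refl: "w \<in> finite_weyl \<Longrightarrow> \<alpha> \<in> simple_roots \<Longrightarrow> root_reflection \<alpha> \<circ> w \<in> finite_weyl"

text \<open>The Weyl group fixes the line orthogonal to the plane of weights, so the determinant on
  3-space is the determinant on that plane.\<close>

definition weyl_det :: "(real^3 \<Rightarrow> real^3) \<Rightarrow> real" where
  "weyl_det w = det (matrix w)"

definition shifted_action :: "(real^3 \<Rightarrow> real^3) \<Rightarrow> real^3 \<Rightarrow> real^3" where
  "shifted_action w lam = w (lam + rho) - rho"

section \<open>The extended affine Weyl group\<close>

text \<open>The pair \<open>(w, \<beta>)\<close> stands for \<open>w t\<^sub>\<beta>\<close>.  Since \<open>w t\<^sub>\<beta> w\<inverse> = t\<^sub>w\<^sub>\<beta>\<close>, the product of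
  \<open>v t\<^sub>\<beta>\<close> and \<open>w t\<^sub>\<gamma>\<close> has translation part \<open>w\<inverse> \<beta> + \<gamma>\<close>.  (The inverse is
  written \<open>inv_into UNIV\<close> because \<open>inv\<close> is also group notation.)\<close>

type_synonym ext_weyl_elt = "(real^3 \<Rightarrow> real^3) \<times> (real^3)"

definition ext_affine_weyl :: "ext_weyl_elt monoid" where
  "ext_affine_weyl =
    \<lparr>carrier = finite_weyl \<times> weight_lattice,
     mult = (\<lambda>(v, \<beta>) (w, \<gamma>). (v \<circ> w, inv_into UNIV w \<beta> + \<gamma>)),
     one = (id, 0)\<rparr>"

definition affine_weyl :: "ext_weyl_elt set" where
  "affine_weyl = finite_weyl \<times> root_lattice"

text \<open>\<open>ext_elt w lam\<close> is \<open>w t\<^bsub>-lam\<^esub>\<close>.\<close>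

definition ext_elt :: "(real^3 \<Rightarrow> real^3) \<Rightarrow> real^3 \<Rightarrow> ext_weyl_elt" where
  "ext_elt w lam = (w, - lam)"

definition iota :: "ext_weyl_elt \<Rightarrow> real^3" where
  "iota = (\<lambda>(w, \<beta>). 3 *\<^sub>R (- \<beta>) + shifted_action (inv_into UNIV w) 0)"

definition ext_weyl_plus :: "ext_weyl_elt set" where
  "ext_weyl_plus = {ext_elt w lam | w lam. w \<in> finite_weyl \<and> lam \<in> dominant_weights \<and>
     (\<forall>\<alpha>\<in>simple_roots. w \<alpha> \<in> neg_roots \<longrightarrow> lam \<bullet> \<alpha> > 0)}"

section \<open>Irreducible modules of sl(3)\<close>

definition sl3 :: "(complex^3^3) set" where
  "sl3 = {A. trace A = 0}"

definition cartan :: "(complex^3^3) set" where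
  "cartan = {H \<in> sl3. \<forall>i j. i \<noteq> j \<longrightarrow> H $ i $ j = 0}"

definition lie_bracket :: "complex^3^3 \<Rightarrow> complex^3^3 \<Rightarrow> complex^3^3" where
  "lie_bracket A B = A ** B - B ** A"

definition mat_scale :: "complex \<Rightarrow> complex^3^3 \<Rightarrow> complex^3^3" where
  "mat_scale c A = (\<chi> i j. c * A $ i $ j)"

definition mat_unit :: "3 \<Rightarrow> 3 \<Rightarrow> complex^3^3" where
  "mat_unit i j = (\<chi> k l. if k = i \<and> l = j then 1 else 0)"

definition weight_eval :: "real^3 \<Rightarrow> complex^3^3 \<Rightarrow> complex" where
  "weight_eval \<mu> H = (\<Sum>i\<in>UNIV. complex_of_real (\<mu> $ i) * H $ i $ i)"

text \<open>Complex sequences serve as the ambient space in which finite-dimensional modules are taken;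
  every finite-dimensional complex vector space is isomorphic to a subspace.\<close>

type_synonym cseq = "nat \<Rightarrow> complex"

definition seq_scale :: "complex \<Rightarrow> cseq \<Rightarrow> cseq" where
  "seq_scale c f = (\<lambda>i. c * f i)"

global_interpretation cs: vector_space seq_scale
  by unfold_locales (auto simp: seq_scale_def fun_eq_iff algebra_simps)

type_synonym sl3_rep = "cseq set \<times> (complex^3^3 \<Rightarrow> cseq \<Rightarrow> cseq)"

definition sl3_module :: "sl3_rep \<Rightarrow> bool" where
  "sl3_module = (\<lambda>(V, act).
     cs.subspace V \<and> (\<exists>B. finite B \<and> V = cs.span B) \<and>
     (\<forall>A\<in>sl3. \<forall>v\<in>V. act A v \<in> V) \<and>
     (\<forall>A\<in>sl3. \<forall>u\<in>V. \<forall>v\<in>V. act A (u + v) = act A u + act A v) \<and>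
     (\<forall>A\<in>sl3. \<forall>c. \<forall>v\<in>V. act A (seq_scale c v) = seq_scale c (act A v)) \<and>
     (\<forall>A\<in>sl3. \<forall>B\<in>sl3. \<forall>v\<in>V. act (A + B) v = act A v + act B v) \<and>
     (\<forall>A\<in>sl3. \<forall>c. \<forall>v\<in>V. act (mat_scale c A) v = seq_scale c (act A v)) \<and>
     (\<forall>A\<in>sl3. \<forall>B\<in>sl3. \<forall>v\<in>V.
        act (lie_bracket A B) v = act A (act B v) - act B (act A v)))"

definition irreducible_module :: "sl3_rep \<Rightarrow> bool" where
  "irreducible_module = (\<lambda>(V, act).
     sl3_module (V, act) \<and> V \<noteq> {0} \<and>
     (\<forall>U. cs.subspace U \<and> U \<subseteq> V \<and> (\<forall>A\<in>sl3. \<forall>u\<in>U. act A u \<in> U) \<longrightarrow> U = {0} \<or> U = V))"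

definition weight_space :: "sl3_rep \<Rightarrow> real^3 \<Rightarrow> cseq set" where
  "weight_space = (\<lambda>(V, act) \<mu>. {v \<in> V. \<forall>H\<in>cartan. act H v = seq_scale (weight_eval \<mu> H) v})"

text \<open>\<open>mat_unit 1 2\<close> and \<open>mat_unit 2 3\<close> are the root vectors of \<open>\<alpha>1\<close> and \<open>\<alpha>2\<close>.\<close>

definition has_highest_weight :: "sl3_rep \<Rightarrow> real^3 \<Rightarrow> bool" where
  "has_highest_weight M lam \<longleftrightarrow>
     (\<exists>v \<in> weight_space M lam. v \<noteq> 0 \<and> snd M (mat_unit 1 2) v = 0 \<and> snd M (mat_unit 2 3) v = 0)"

text \<open>For dominant \<open>lam\<close> such a module exists and is unique up to isomorphism, so that dimensions
  do not depend on the choice.\<close>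

definition irr_module :: "real^3 \<Rightarrow> sl3_rep" where
  "irr_module lam = (SOME M. irreducible_module M \<and> has_highest_weight M lam)"

definition weight_mult :: "real^3 \<Rightarrow> real^3 \<Rightarrow> nat" where
  "weight_mult lam \<mu> = cs.dim (weight_space (irr_module lam) \<mu>)"

definition irr_dim :: "real^3 \<Rightarrow> nat" where
  "irr_dim lam = cs.dim (fst (irr_module lam))"

section \<open>Generalised weight multiplicities\<close>

definition gen_mult :: "ext_weyl_elt \<Rightarrow> ext_weyl_elt \<Rightarrow> nat" where
  "gen_mult y z =
     (if z \<in> affine_weyl #>\<^bsub>ext_affine_weyl\<^esub> y then weight_mult (iota y) (iota z) else 0)"

definition gen_dim :: "ext_weyl_elt \<Rightarrow> nat" where
  "gen_dim y = (\<Sum>\<^sub>\<infinity>z\<in>carrier ext_affine_weyl. gen_mult y z)"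

end

theory Submission imports Defs begin

text \<open>
  On the coset \<open>W y\<close> the map \<open>iota\<close> is a bijection onto the weights of the root lattice \<open>Q\<close> that lie
  in \<open>3P\<close> or in \<open>3P - \<alpha>1\<close>, whichever coset it is (\<open>coset_bij\<close>).  Hence \<open>D\<^sub>y\<close> is the dimension of the
  irreducible module \<open>L\<close> of highest weight \<open>iota y\<close>, less the part of \<open>L\<close> carried by the third class
  \<open>3P + \<alpha>1\<close> of \<open>Q\<close> modulo \<open>3P\<close>.  To find the size of that part, evaluate the character of \<open>L\<close> at the
  element of order three of the torus at which both simple roots take the value of a primitive
  cube root of unity \<open>\<omega>\<close>.  The value is 1 if \<open>iota y\<close> lies in \<open>3P\<close> and -1 if it lies in
  \<open>3P - \<alpha>1\<close>, that is, it is \<open>det y\<close>.  As 1, \<open>\<omega>\<close>, \<open>\<omega>\<^sup>2\<close> have the sole rational relation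
  \<open>1 + \<omega> + \<omega>\<^sup>2 = 0\<close>, this integer value shows that the three classes carry equal dimensions except
  that the class \<open>3P\<close> has \<open>det y\<close> more (\<open>card_height3\<close>).  The third class therefore has dimension
  \<open>(dim L - det y) / 3\<close>, and what remains is \<open>2/3 dim L + det y / 3\<close>.  The product formulas come from
  the Weyl dimension formula for \<open>sl(3)\<close> and the invariance of the inner product under the Weyl group.

  The character and the dimension of \<open>L\<close> are read off a concrete model.  For highest weight
  \<open>a \<Lambda>1 + b \<Lambda>2\<close> take the polynomials in \<open>x\<^sub>1, x\<^sub>2, x\<^sub>3, y\<^sub>1, y\<^sub>2, y\<^sub>3\<close>, homogeneous of degree \<open>a\<close> in the
  \<open>x\<close> and \<open>b\<close> in the \<open>y\<close>, that are killed by the Laplacian \<open>\<Sum>\<^sub>i \<partial>\<^sup>2/\<partial>x\<^sub>i\<partial>y\<^sub>i\<close>; the matrix unit \<open>E\<^sub>i\<^sub>j\<close> acts as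
  \<open>x\<^sub>i \<partial>/\<partial>x\<^sub>j - y\<^sub>j \<partial>/\<partial>y\<^sub>i\<close>, which commutes with the Laplacian.  The Laplace equation expresses each
  coefficient at a multiple of \<open>x\<^sub>2 y\<^sub>2\<close> by two others, so a harmonic polynomial is given by arbitrary
  coefficients at the monomials not divisible by \<open>x\<^sub>2 y\<^sub>2\<close>, and dimensions of weight spaces become
  numbers of such monomials (\<open>harm_sub_dim\<close>).  The model is irreducible (\<open>harmonic_irreducible\<close>):
  it has only one singular vector up to scalars (\<open>singular_unique\<close>), every nonzero submodule contains
  a singular vector, and for the form that makes raising and lowering operators adjoint the orthogonal
  complement of a submodule is a submodule, which would contain that same vector.

  Since \<open>irr_module\<close> is an arbitrary choice, the numbers found for the model have to be carried over
  to it.  In the direct sum of two irreducible modules with the same highest weight, the submodule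
  generated by the pair of highest weight vectors is the graph of an isomorphism
  (\<open>highest_weight_unique\<close>), and this preserves all weight spaces.
\<close>

section \<open>Highest weight vectors and the submodules they generate\<close>

lemma mat_unit_sl3: "i \<noteq> j \<Longrightarrow> mat_unit i j \<in> sl3"
  by (auto simp: sl3_def trace_def mat_unit_def intro!: sum.neutral)

lemma cartan_sl3: "H \<in> cartan \<Longrightarrow> H \<in> sl3"
  by (simp add: cartan_def)

lemma bracket_units:
  "lie_bracket (mat_unit 1 2) (mat_unit 2 3) = mat_unit 1 3"
  "lie_bracket (mat_unit 3 2) (mat_unit 2 1) = mat_unit 3 1"
  "lie_bracket (mat_unit 1 2) (mat_unit 3 2) = 0"
  "lie_bracket (mat_unit 2 3) (mat_unit 2 1) = 0"
  by (simp_all add: lie_bracket_def mat_unit_def vec_eq_iff forall_3 matrix_matrix_mult_def sum_3)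

lemma bracket_cartan:
  "lie_bracket (mat_unit 1 2) (mat_unit 2 1) \<in> cartan"
  "lie_bracket (mat_unit 2 3) (mat_unit 3 2) \<in> cartan"
  by (simp_all add: cartan_def sl3_def trace_def lie_bracket_def mat_unit_def forall_3 matrix_matrix_mult_def sum_3)

lemma bracket_cartan_unit:
  "H \<in> cartan \<Longrightarrow> lie_bracket H (mat_unit i j) = mat_scale (H $ i $ i - H $ j $ j) (mat_unit i j)"
  using exhaust_3[of i] exhaust_3[of j]
  by (auto simp: cartan_def lie_bracket_def mat_unit_def mat_scale_def vec_eq_iff forall_3
     matrix_matrix_mult_def sum_3)

text \<open>This element of the Cartan subalgebra acts on a weight vector by the height of its weight, so its
  eigenvalues grade a highest weight module by the number of lowering operators applied.\<close>

definition coweight_rho :: "complex^3^3" where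
  "coweight_rho = mat_unit 1 1 - mat_unit 3 3"

lemma coweight_rho_cartan: "coweight_rho \<in> cartan"
  by (simp add: coweight_rho_def cartan_def sl3_def trace_def mat_unit_def forall_3 sum_3)

lemma sl3_decomposition:
  assumes "A \<in> sl3"
  obtains H where "H \<in> cartan"
    "A = H + mat_scale (A$1$2) (mat_unit 1 2) + mat_scale (A$2$3) (mat_unit 2 3)
       + mat_scale (A$1$3) (mat_unit 1 3) + mat_scale (A$2$1) (mat_unit 2 1)
       + mat_scale (A$3$2) (mat_unit 3 2) + mat_scale (A$3$1) (mat_unit 3 1)"
proof
  let ?H = "(\<chi> i j. if i = j then A$i$j else 0) :: complex^3^3"
  show "?H \<in> cartan" using assms
    by (simp add: cartan_def sl3_def trace_def)
  show "A = ?H + mat_scale (A$1$2) (mat_unit 1 2) + mat_scale (A$2$3) (mat_unit 2 3)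
       + mat_scale (A$1$3) (mat_unit 1 3) + mat_scale (A$2$1) (mat_unit 2 1)
       + mat_scale (A$3$2) (mat_unit 3 2) + mat_scale (A$3$1) (mat_unit 3 1)"
    by (simp add: vec_eq_iff forall_3 mat_scale_def mat_unit_def)
qed

lemma sl3_add: "A \<in> sl3 \<Longrightarrow> B \<in> sl3 \<Longrightarrow> A + B \<in> sl3"
  by (simp add: sl3_def trace_add)

lemma sl3_scale: "A \<in> sl3 \<Longrightarrow> mat_scale c A \<in> sl3"
  by (simp add: sl3_def trace_def mat_scale_def flip: sum_distrib_left)

text \<open>The underlying vector space is left abstract because three kinds are needed: the sequences in which
  the chosen irreducible modules live, the coefficient functions of the model, and pairs of both.\<close>

locale sl3_rep_on = vector_space scale
  for scale :: "complex \<Rightarrow> 'v::ab_group_add \<Rightarrow> 'v" +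
  fixes V :: "'v set" and act :: "complex^3^3 \<Rightarrow> 'v \<Rightarrow> 'v"
  assumes subspace_V: "subspace V"
    and act_closed: "\<And>A v. A \<in> sl3 \<Longrightarrow> v \<in> V \<Longrightarrow> act A v \<in> V"
    and act_add: "\<And>A u v. A \<in> sl3 \<Longrightarrow> u \<in> V \<Longrightarrow> v \<in> V \<Longrightarrow> act A (u + v) = act A u + act A v"
    and act_scale: "\<And>A c v. A \<in> sl3 \<Longrightarrow> v \<in> V \<Longrightarrow> act A (scale c v) = scale c (act A v)"
    and act_mat_add: "\<And>A B v. A \<in> sl3 \<Longrightarrow> B \<in> sl3 \<Longrightarrow> v \<in> V \<Longrightarrow> act (A + B) v = act A v + act B v"
    and act_mat_scale: "\<And>A c v. A \<in> sl3 \<Longrightarrow> v \<in> V \<Longrightarrow> act (mat_scale c A) v = scale c (act A v)"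
    and act_bracket: "\<And>A B v. A \<in> sl3 \<Longrightarrow> B \<in> sl3 \<Longrightarrow> v \<in> V \<Longrightarrow>
       act (lie_bracket A B) v = act A (act B v) - act B (act A v)"
begin

definition submodule :: "'v set \<Rightarrow> bool" where
  "submodule U \<longleftrightarrow> subspace U \<and> U \<subseteq> V \<and> (\<forall>A\<in>sl3. \<forall>u\<in>U. act A u \<in> U)"

definition irreducible :: bool where
  "irreducible \<longleftrightarrow> V \<noteq> {0} \<and> (\<forall>U. submodule U \<longrightarrow> U = {0} \<or> U = V)"

definition wspace :: "real^3 \<Rightarrow> 'v set" where
  "wspace \<mu> = {v \<in> V. \<forall>H\<in>cartan. act H v = scale (weight_eval \<mu> H) v}"

definition singular :: "'v \<Rightarrow> bool" where
  "singular v \<longleftrightarrow> act (mat_unit 1 2) v = 0 \<and> act (mat_unit 2 3) v = 0"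

lemma V_0: "0 \<in> V" and V_add: "u \<in> V \<Longrightarrow> v \<in> V \<Longrightarrow> u + v \<in> V"
  and V_scale: "v \<in> V \<Longrightarrow> scale c v \<in> V"
  using subspace_V by (auto simp: subspace_def)

lemma act_0 [simp]: "A \<in> sl3 \<Longrightarrow> act A 0 = 0"
  using act_scale[of A 0 0] V_0 by simp

lemma act_zero_mat: "v \<in> V \<Longrightarrow> act 0 v = 0"
proof -
  assume v: "v \<in> V"
  have "mat_scale 0 (mat_unit 1 2) = 0" by (simp add: mat_scale_def vec_eq_iff)
  then show ?thesis using act_mat_scale[OF mat_unit_sl3[of 1 2] v, of 0] by simp
qed

lemma act_comm: "A \<in> sl3 \<Longrightarrow> B \<in> sl3 \<Longrightarrow> v \<in> V \<Longrightarrow>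
    act A (act B v) = act B (act A v) + act (lie_bracket A B) v"
  by (simp add: act_bracket)

lemma subspace_wspace: "subspace (wspace \<mu>)"
  by (auto simp: subspace_def wspace_def V_0 V_add V_scale act_add act_scale cartan_sl3
      scale_right_distrib scale_left_commute)

end

context sl3_rep_on begin

text \<open>\<open>level z n\<close> is spanned by the words of length \<open>n\<close> in the two simple lowering operators, applied to
  \<open>z\<close>.  The Lie algebra is generated by simple raising and lowering operators, so for a singular weight
  vector \<open>z\<close> the sum of all levels will be the submodule generated by \<open>z\<close>.\<close>

primrec level :: "'v \<Rightarrow> nat \<Rightarrow> 'v set" where
  "level z 0 = range (\<lambda>c. scale c z)"
| "level z (Suc n) = {act (mat_unit 2 1) x + act (mat_unit 3 2) y | x y. x \<in> level z n \<and> y \<in> level z n}"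

primrec levels_below :: "'v \<Rightarrow> nat \<Rightarrow> 'v set" where
  "levels_below z 0 = {0}"
| "levels_below z (Suc n) = {x + y | x y. x \<in> levels_below z n \<and> y \<in> level z n}"

context
  fixes z :: 'v and lam :: "real^3"
  assumes z: "z \<in> wspace lam" and sing: "singular z"
begin

lemma zV: "z \<in> V" using z by (simp add: wspace_def)

lemma level_SucI: "x \<in> level z n \<Longrightarrow> y \<in> level z n \<Longrightarrow>
    act (mat_unit 2 1) x + act (mat_unit 3 2) y \<in> level z (Suc n)"
  by simp blast

lemma level_SucE:
  assumes "x \<in> level z (Suc n)"
  obtains p q where "p \<in> level z n" "q \<in> level z n"
    "x = act (mat_unit 2 1) p + act (mat_unit 3 2) q"
  using assms by auto

lemma level_sub: "level z n \<subseteq> V" and level_subspace: "subspace (level z n)"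
proof (induction n)
  case 0
  show "level z 0 \<subseteq> V" by (auto simp: zV V_scale)
  have "0 = scale 0 z" by simp
  then show "subspace (level z 0)"
    by (auto simp: subspace_def simp del: scale_zero_left simp flip: scale_left_distrib)
next
  case (Suc n)
  show "level z (Suc n) \<subseteq> V"
    using Suc by (auto intro!: V_add act_closed mat_unit_sl3)
  show "subspace (level z (Suc n))"
    unfolding subspace_def
  proof (intro conjI ballI allI)
    have "0 = act (mat_unit 2 1) 0 + act (mat_unit 3 2) 0" by (simp add: mat_unit_sl3)
    then show "0 \<in> level z (Suc n)" using Suc(2) by (auto simp: subspace_def)
  next
    fix u v assume "u \<in> level z (Suc n)" "v \<in> level z (Suc n)"
    then obtain x y x' y' where h: "x \<in> level z n" "y \<in> level z n" "x' \<in> level z n" "y' \<in> level z n"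
      "u = act (mat_unit 2 1) x + act (mat_unit 3 2) y"
      "v = act (mat_unit 2 1) x' + act (mat_unit 3 2) y'" by auto
    then have "u + v = act (mat_unit 2 1) (x + x') + act (mat_unit 3 2) (y + y')"
      using Suc(1) by (subst (1 2) act_add) (auto simp: mat_unit_sl3)
    then show "u + v \<in> level z (Suc n)"
      using h Suc(2) by (metis level_SucI subspace_add)
  next
    fix c u assume "u \<in> level z (Suc n)"
    then obtain x y where h: "x \<in> level z n" "y \<in> level z n"
      "u = act (mat_unit 2 1) x + act (mat_unit 3 2) y" by auto
    then have "scale c u = act (mat_unit 2 1) (scale c x) + act (mat_unit 3 2) (scale c y)"
      using Suc(1) by (subst (1 2) act_scale) (auto simp: mat_unit_sl3 scale_right_distrib)
    then show "scale c u \<in> level z (Suc n)"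
      using h Suc(2) by (metis level_SucI subspace_scale)
  qed
qed

lemma lower_level:
  assumes "x \<in> level z n"
  shows "act (mat_unit 2 1) x \<in> level z (Suc n)" "act (mat_unit 3 2) x \<in> level z (Suc n)"
proof -
  have 0: "0 \<in> level z n" using level_subspace subspace_0 by blast
  show "act (mat_unit 2 1) x \<in> level z (Suc n)" "act (mat_unit 3 2) x \<in> level z (Suc n)"
    using level_SucI[OF assms 0] level_SucI[OF 0 assms] by (simp_all add: mat_unit_sl3)
qed

lemma cartan_lower:
  assumes "H \<in> cartan" "x \<in> V" "i \<noteq> j"
  shows "act H (act (mat_unit i j) x)
    = act (mat_unit i j) (act H x) + scale (H $ i $ i - H $ j $ j) (act (mat_unit i j) x)"
  using assms by (simp add: act_comm[of H] cartan_sl3 mat_unit_sl3 bracket_cartan_unit act_mat_scale)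

lemma cartan_level: "H \<in> cartan \<Longrightarrow> x \<in> level z n \<Longrightarrow> act H x \<in> level z n"
proof (induction n arbitrary: x)
  case 0
  then obtain c where "x = scale c z" by auto
  then have "act H x = scale (c * weight_eval lam H) z"
    using z 0 by (simp add: act_scale cartan_sl3 zV wspace_def)
  then show ?case by (simp only: level.simps) (rule rangeI)
next
  case (Suc n)
  then obtain p q where h: "p \<in> level z n" "q \<in> level z n"
    "x = act (mat_unit 2 1) p + act (mat_unit 3 2) q" by auto
  then have pq: "p \<in> V" "q \<in> V" using level_sub by auto
  have "act H x = act H (act (mat_unit 2 1) p) + act H (act (mat_unit 3 2) q)"
    unfolding h by (rule act_add) (auto simp: Suc cartan_sl3 act_closed pq mat_unit_sl3)
  then show ?case
    using Suc.IH[OF Suc.prems(1) h(1)] Suc.IH[OF Suc.prems(1) h(2)] lower_level[OF h(1)] lower_level[OF h(2)]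
    by (auto simp: cartan_lower Suc.prems pq simp del: level.simps
        intro!: subspace_add[OF level_subspace] subspace_scale[OF level_subspace] lower_level)
qed

lemma raise_level_0:
  assumes "x \<in> level z 0"
  shows "act (mat_unit 1 2) x = 0" "act (mat_unit 2 3) x = 0"
  using assms sing by (auto simp: act_scale zV mat_unit_sl3 singular_def)

text \<open>A raising and a lowering operator for different simple roots commute, so pulling a raising operator
  past one lowering step leaves only a Cartan term.  This is what makes raising operators map each level
  to the previous one.\<close>

lemma raise_lower:
  assumes "p \<in> V" "q \<in> V"
  shows "act (mat_unit 1 2) (act (mat_unit 2 1) p + act (mat_unit 3 2) q)
      = act (mat_unit 2 1) (act (mat_unit 1 2) p) + act (mat_unit 3 2) (act (mat_unit 1 2) q)
        + act (lie_bracket (mat_unit 1 2) (mat_unit 2 1)) p"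
    and "act (mat_unit 2 3) (act (mat_unit 2 1) p + act (mat_unit 3 2) q)
      = act (mat_unit 2 1) (act (mat_unit 2 3) p) + act (mat_unit 3 2) (act (mat_unit 2 3) q)
        + act (lie_bracket (mat_unit 2 3) (mat_unit 3 2)) q"
proof -
  have m: "mat_unit 1 2 \<in> sl3" "mat_unit 2 3 \<in> sl3" "mat_unit 2 1 \<in> sl3" "mat_unit 3 2 \<in> sl3"
    by (simp_all add: mat_unit_sl3)
  have "act (mat_unit 1 2) (act (mat_unit 3 2) q) = act (mat_unit 3 2) (act (mat_unit 1 2) q)"
    "act (mat_unit 2 3) (act (mat_unit 2 1) p) = act (mat_unit 2 1) (act (mat_unit 2 3) p)"
    using act_comm[OF m(1,4) assms(2)] act_comm[OF m(2,3) assms(1)]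
    by (simp_all add: bracket_units act_zero_mat assms)
  moreover note act_comm[OF m(1,3) assms(1)] act_comm[OF m(2,4) assms(2)]
  ultimately show "act (mat_unit 1 2) (act (mat_unit 2 1) p + act (mat_unit 3 2) q)
      = act (mat_unit 2 1) (act (mat_unit 1 2) p) + act (mat_unit 3 2) (act (mat_unit 1 2) q)
        + act (lie_bracket (mat_unit 1 2) (mat_unit 2 1)) p"
    and "act (mat_unit 2 3) (act (mat_unit 2 1) p + act (mat_unit 3 2) q)
      = act (mat_unit 2 1) (act (mat_unit 2 3) p) + act (mat_unit 3 2) (act (mat_unit 2 3) q)
        + act (lie_bracket (mat_unit 2 3) (mat_unit 3 2)) q"
    using assms m by (simp_all only: act_add act_closed add_ac)
qed

lemma raise_level_Suc:
  "x \<in> level z (Suc n) \<Longrightarrow> act (mat_unit 1 2) x \<in> level z n \<and> act (mat_unit 2 3) x \<in> level z n"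
proof (induction n arbitrary: x)
  case 0
  obtain p q where h: "p \<in> level z 0" "q \<in> level z 0"
    "x = act (mat_unit 2 1) p + act (mat_unit 3 2) q" by (rule level_SucE[OF 0])
  have pq: "p \<in> V" "q \<in> V" using h level_sub by blast+
  show ?case
    unfolding h(3) raise_lower[OF pq] raise_level_0[OF h(1)] raise_level_0[OF h(2)]
    using cartan_level[OF bracket_cartan(1) h(1)] cartan_level[OF bracket_cartan(2) h(2)]
    by (simp add: mat_unit_sl3 del: level.simps)
next
  case (Suc n)
  obtain p q where h: "p \<in> level z (Suc n)" "q \<in> level z (Suc n)"
    "x = act (mat_unit 2 1) p + act (mat_unit 3 2) q" by (rule level_SucE[OF Suc.prems])
  have pq: "p \<in> V" "q \<in> V" using h level_sub by blast+
  show ?case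
    unfolding h(3) raise_lower[OF pq]
    using cartan_level[OF bracket_cartan(1) h(1)] cartan_level[OF bracket_cartan(2) h(2)]
      Suc.IH[OF h(1)] Suc.IH[OF h(2)]
    by (intro conjI subspace_add[OF level_subspace] level_SucI) blast+
qed

lemma level_eigenvalue:
  "x \<in> level z n \<Longrightarrow> act coweight_rho x = scale (weight_eval lam coweight_rho - of_nat n) x"
proof (induction n arbitrary: x)
  case 0
  then show ?case using z
    by (auto simp: act_scale cartan_sl3 zV coweight_rho_cartan wspace_def)
next
  case (Suc n)
  then obtain p q where h: "p \<in> level z n" "q \<in> level z n"
    "x = act (mat_unit 2 1) p + act (mat_unit 3 2) q" by auto
  then have pq: "p \<in> V" "q \<in> V" using level_sub by auto
  have v: "coweight_rho $ 1 $ 1 = 1" "coweight_rho $ 2 $ 2 = 0" "coweight_rho $ 3 $ 3 = -1"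
    by (simp_all add: coweight_rho_def mat_unit_def)
  have "act coweight_rho x = act coweight_rho (act (mat_unit 2 1) p) + act coweight_rho (act (mat_unit 3 2) q)"
    unfolding h by (rule act_add) (auto simp: coweight_rho_cartan cartan_sl3 act_closed pq mat_unit_sl3)
  then show ?case
    unfolding h(3) cartan_lower[OF coweight_rho_cartan pq(1), of 2 1, simplified]
      cartan_lower[OF coweight_rho_cartan pq(2), of 3 2, simplified] Suc.IH[OF h(1)] Suc.IH[OF h(2)] v
      act_scale[OF mat_unit_sl3[of 2 1, simplified] pq(1)] act_scale[OF mat_unit_sl3[of 3 2, simplified] pq(2)]
    by (simp add: scale_right_distrib scale_left_distrib scale_left_diff_distrib)
qed

lemma levels_sub: "levels_below z n \<subseteq> V" and levels_subspace: "subspace (levels_below z n)"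
proof (induction n)
  case (Suc n)
  show "levels_below z (Suc n) \<subseteq> V"
    using Suc(1) level_sub by (auto intro!: V_add)
  show "subspace (levels_below z (Suc n))"
    using subspace_sums[OF Suc(2) level_subspace[of n]] by simp
qed (auto simp: V_0)

lemma levels_mono: "n \<le> k \<Longrightarrow> levels_below z n \<subseteq> levels_below z k"
proof (induction k rule: dec_induct)
  case (step k)
  have "0 \<in> level z k" using level_subspace subspace_0 by blast
  then have "levels_below z k \<subseteq> levels_below z (Suc k)" by force
  then show ?case using step by blast
qed auto

lemma level_levels: "x \<in> level z n \<Longrightarrow> x \<in> levels_below z (Suc n)"
  using subspace_0[OF levels_subspace[of n]] unfolding levels_below.simps
  by (intro CollectI exI[of _ 0] exI[of _ x]) simp

definition generated :: "'v set" where "generated = (\<Union>n. levels_below z n)"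

lemma generated_subspace: "subspace generated"
  unfolding subspace_def
proof (intro conjI ballI allI)
  show "0 \<in> generated" unfolding generated_def by (auto intro: exI[of _ 0])
next
  fix u v assume "u \<in> generated" "v \<in> generated"
  then obtain n k where "u \<in> levels_below z n" "v \<in> levels_below z k"
    unfolding generated_def by auto
  then have "u \<in> levels_below z (max n k)" "v \<in> levels_below z (max n k)"
    using levels_mono[of n "max n k"] levels_mono[of k "max n k"] by auto
  then show "u + v \<in> generated"
    unfolding generated_def using subspace_add[OF levels_subspace] by blast
next
  fix c u assume "u \<in> generated"
  then show "scale c u \<in> generated"
    unfolding generated_def using subspace_scale[OF levels_subspace] by blast
qed

lemma generated_closed_basic:
  assumes A: "A \<in> sl3" and lev: "\<And>n x. x \<in> level z n \<Longrightarrow> act A x \<in> generated"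
    and u: "u \<in> generated"
  shows "act A u \<in> generated"
proof -
  have "u \<in> levels_below z n \<Longrightarrow> act A u \<in> generated" for n u
  proof (induction n arbitrary: u)
    case 0
    then show ?case using A subspace_0[OF generated_subspace] by simp
  next
    case (Suc n)
    then obtain x y where "u = x + y" "x \<in> levels_below z n" "y \<in> level z n" by auto
    then show ?case using Suc.IH[of x] lev[of y n] level_sub[of n] levels_sub[of n] A
      by (auto simp: act_add subsetD intro!: subspace_add[OF generated_subspace])
  qed
  then show ?thesis using u unfolding generated_def by auto
qed

lemma submodule_generated: "submodule generated"
proof -
  have GV: "generated \<subseteq> V" using levels_sub unfolding generated_def by auto
  have lg: "x \<in> level z n \<Longrightarrow> x \<in> generated" for x n
    unfolding generated_def using level_levels by blast
  have g0: "0 \<in> generated" using subspace_0[OF generated_subspace] .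
  have f: "act (mat_unit 2 1) u \<in> generated" "act (mat_unit 3 2) u \<in> generated" if "u \<in> generated" for u
    by (rule generated_closed_basic[OF _ _ that], simp add: mat_unit_sl3, rule lg, erule lower_level)+
  have e: "act (mat_unit 1 2) u \<in> generated" "act (mat_unit 2 3) u \<in> generated" if "u \<in> generated" for u
  proof -
    have ex: "act (mat_unit 1 2) x \<in> generated \<and> act (mat_unit 2 3) x \<in> generated" if "x \<in> level z n" for x n
    proof (cases n)
      case 0
      then show ?thesis using raise_level_0[of x] g0 that by simp
    next
      case (Suc k)
      then show ?thesis using raise_level_Suc[of x k] lg that by blast
    qed
    show "act (mat_unit 1 2) u \<in> generated" "act (mat_unit 2 3) u \<in> generated"
      by (rule generated_closed_basic[OF _ _ that], simp add: mat_unit_sl3, use ex in blast)+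
  qed
  have h: "act H u \<in> generated" if "u \<in> generated" "H \<in> cartan" for u H
    by (rule generated_closed_basic[OF cartan_sl3[OF that(2)] _ that(1)], rule lg, rule cartan_level[OF that(2)])
  have e3: "act (mat_unit 1 3) u \<in> generated" "act (mat_unit 3 1) u \<in> generated" if u: "u \<in> generated" for u
  proof -
    have uV: "u \<in> V" using u GV by auto
    have "act (mat_unit 1 3) u = act (mat_unit 1 2) (act (mat_unit 2 3) u) - act (mat_unit 2 3) (act (mat_unit 1 2) u)"
      by (subst act_bracket[symmetric]) (simp_all add: bracket_units mat_unit_sl3 uV)
    then show "act (mat_unit 1 3) u \<in> generated"
      using e u subspace_diff[OF generated_subspace] by simp
    have "act (mat_unit 3 1) u = act (mat_unit 3 2) (act (mat_unit 2 1) u) - act (mat_unit 2 1) (act (mat_unit 3 2) u)"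
      by (subst act_bracket[symmetric]) (simp_all add: bracket_units mat_unit_sl3 uV)
    then show "act (mat_unit 3 1) u \<in> generated"
      using f u subspace_diff[OF generated_subspace] by simp
  qed
  have "act A u \<in> generated" if A: "A \<in> sl3" and u: "u \<in> generated" for A u
  proof -
    obtain H where H: "H \<in> cartan" and dec:
      "A = H + mat_scale (A$1$2) (mat_unit 1 2) + mat_scale (A$2$3) (mat_unit 2 3)
       + mat_scale (A$1$3) (mat_unit 1 3) + mat_scale (A$2$1) (mat_unit 2 1)
       + mat_scale (A$3$2) (mat_unit 3 2) + mat_scale (A$3$1) (mat_unit 3 1)"
      using sl3_decomposition[OF A] by blast
    have uV: "u \<in> V" using u GV by auto
    have "act A u = act H u + scale (A$1$2) (act (mat_unit 1 2) u) + scale (A$2$3) (act (mat_unit 2 3) u)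
       + scale (A$1$3) (act (mat_unit 1 3) u) + scale (A$2$1) (act (mat_unit 2 1) u)
       + scale (A$3$2) (act (mat_unit 3 2) u) + scale (A$3$1) (act (mat_unit 3 1) u)"
      by (subst dec) (simp add: act_mat_add act_mat_scale sl3_add sl3_scale mat_unit_sl3 cartan_sl3 H uV)
    then show ?thesis
      using e[OF u] f[OF u] e3[OF u] h[OF u H]
      by (auto intro!: subspace_add[OF generated_subspace] subspace_scale[OF generated_subspace])
  qed
  then show ?thesis unfolding submodule_def using generated_subspace GV by blast
qed

lemma cartan_levels: "H \<in> cartan \<Longrightarrow> x \<in> levels_below z n \<Longrightarrow> act H x \<in> levels_below z n"
proof (induction n arbitrary: x)
  case (Suc n)
  then obtain u y where "x = u + y" "u \<in> levels_below z n" "y \<in> level z n" by auto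
  moreover from this have "u \<in> V" "y \<in> V" using levels_sub[of n] level_sub[of n] by blast+
  ultimately have "act H x = act H u + act H y" "act H u \<in> levels_below z n" "act H y \<in> level z n"
    using Suc by (auto simp: act_add cartan_sl3 cartan_level)
  then show ?case by auto
qed (auto simp: cartan_sl3)

text \<open>The levels are eigenspaces of \<open>coweight_rho\<close> with distinct eigenvalues.  If an eigenvector for the
  highest eigenvalue had a component in the last level, applying \<open>coweight_rho\<close> minus the eigenvalue
  would isolate that component and show that it already lies in the earlier levels.\<close>

lemma generated_top:
  assumes "u \<in> generated" and u: "act coweight_rho u = scale (weight_eval lam coweight_rho) u"
  shows "\<exists>c. u = scale c z"
proof -
  let ?c = "weight_eval lam coweight_rho"
  have "u \<in> levels_below z (Suc n) \<Longrightarrow> u \<in> levels_below z (Suc 0)" for n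
  proof (induction n)
    case (Suc n)
    then obtain x y where h: "u = x + y" "x \<in> levels_below z (Suc n)" "y \<in> level z (Suc n)"
      using Suc.prems unfolding levels_below.simps(2)[of z "Suc n"] by blast
    have V: "x \<in> V" "y \<in> V" using h levels_sub[of "Suc n"] level_sub[of "Suc n"] by blast+
    have "act coweight_rho x + scale (?c - of_nat (Suc n)) y = scale ?c x + scale ?c y"
      using u level_eigenvalue[OF h(3)] V
      by (simp add: h(1) act_add coweight_rho_cartan cartan_sl3 scale_right_distrib)
    then have "scale (of_nat (Suc n)) y = act coweight_rho x - scale ?c x"
      by (simp add: scale_left_diff_distrib algebra_simps)
    then have "scale (of_nat (Suc n)) y \<in> levels_below z (Suc n)"
      using h(2) by (metis cartan_levels coweight_rho_cartan levels_subspace subspace_diff subspace_scale)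
    then have "scale (inverse (of_nat (Suc n))) (scale (of_nat (Suc n)) y) \<in> levels_below z (Suc n)"
      by (rule subspace_scale[OF levels_subspace])
    then have "y \<in> levels_below z (Suc n)" by (simp del: levels_below.simps of_nat_Suc)
    then have "u \<in> levels_below z (Suc n)"
      unfolding h(1) using h(2) by (intro subspace_add[OF levels_subspace])
    then show ?case by (rule Suc.IH)
  qed
  moreover obtain n where "u \<in> levels_below z n" using assms(1) unfolding generated_def by blast
  then have "u \<in> levels_below z (Suc n)" using levels_mono[of n "Suc n"] by auto
  ultimately have "u \<in> levels_below z (Suc 0)" by blast
  then show ?thesis by auto
qed

end

text \<open>The highest weight space of a module generated by a singular vector is a line.  This is the only
  property of highest weight modules that the uniqueness theorem uses.\<close>

lemma highest_weight_submodule: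
  assumes "z \<in> wspace lam" "singular z"
  obtains G where "submodule G" "z \<in> G"
    "\<And>u. u \<in> G \<Longrightarrow> act coweight_rho u = scale (weight_eval lam coweight_rho) u \<Longrightarrow> \<exists>c. u = scale c z"
proof
  show "submodule (generated z)" using submodule_generated[OF assms] .
  have "z = scale 1 z" by simp
  then have "z \<in> level z 0" unfolding level.simps by blast
  then show "z \<in> generated z" using level_levels[OF assms] unfolding generated_def[OF assms] by blast
  show "\<exists>c. u = scale c z" if "u \<in> generated z" "act coweight_rho u = scale (weight_eval lam coweight_rho) u" for u
    using generated_top[OF assms that] .
qed

end

section \<open>Irreducible modules with the same highest weight\<close>

locale two_reps = A: sl3_rep_on scale1 V1 act1 + B: sl3_rep_on scale2 V2 act2
  for scale1 :: "complex \<Rightarrow> 'a::ab_group_add \<Rightarrow> 'a" and V1 act1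
  and scale2 :: "complex \<Rightarrow> 'b::ab_group_add \<Rightarrow> 'b" and V2 act2
begin

definition pair_scale :: "complex \<Rightarrow> 'a \<times> 'b \<Rightarrow> 'a \<times> 'b" where
  "pair_scale c = map_prod (scale1 c) (scale2 c)"
definition pair_act :: "complex^3^3 \<Rightarrow> 'a \<times> 'b \<Rightarrow> 'a \<times> 'b" where
  "pair_act X = map_prod (act1 X) (act2 X)"

sublocale vector_space_pair scale1 scale2 by unfold_locales

sublocale P: vector_space pair_scale
  by unfold_locales
    (auto simp: pair_scale_def A.scale_right_distrib B.scale_right_distrib
      A.scale_left_distrib B.scale_left_distrib)

sublocale P: sl3_rep_on pair_scale "V1 \<times> V2" pair_act
proof unfold_locales
  show "P.subspace (V1 \<times> V2)"
    by (auto simp: P.subspace_def pair_scale_def zero_prod_def A.V_0 B.V_0 A.V_add B.V_add A.V_scale B.V_scale)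
qed (auto simp: pair_scale_def pair_act_def A.act_closed B.act_closed A.act_add B.act_add
    A.act_scale B.act_scale A.act_mat_add B.act_mat_add A.act_mat_scale B.act_mat_scale
    A.act_bracket B.act_bracket)

lemma graph_projections:
  assumes G: "P.submodule G"
  shows "A.submodule (fst ` G)" "B.submodule (snd ` G)"
    "A.submodule {u. (u, 0) \<in> G}" "B.submodule {u. (0, u) \<in> G}"
proof -
  have sG: "P.subspace G" and GV: "G \<subseteq> V1 \<times> V2" using G by (auto simp: P.submodule_def)
  have z: "(0,0) \<in> G" using P.subspace_0[OF sG] by (simp add: zero_prod_def)
  have p: "(u+v,u'+v') \<in> G" if "(u,u') \<in> G" "(v,v') \<in> G" for u v u' v'
    using P.subspace_add[OF sG that] by simp
  have c: "(scale1 c u, scale2 c v) \<in> G" if "(u,v) \<in> G" for c u v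
    using P.subspace_scale[OF sG that, of c] by (simp add: pair_scale_def)
  have m: "(act1 X u, act2 X v) \<in> G" if "X \<in> sl3" "(u,v) \<in> G" for X u v
  proof -
    have "pair_act X (u,v) \<in> G" using G that unfolding P.submodule_def by blast
    then show ?thesis by (simp add: pair_act_def)
  qed
  have im: "fst ` G = {u. \<exists>v. (u,v) \<in> G}" "snd ` G = {v. \<exists>u. (u,v) \<in> G}" by force+
  show "A.submodule (fst ` G)"
    unfolding im A.submodule_def A.subspace_def using z p c m GV by blast
  show "B.submodule (snd ` G)"
    unfolding im B.submodule_def B.subspace_def using z p c m GV by blast
  show "A.submodule {u. (u, 0) \<in> G}"
    unfolding A.submodule_def A.subspace_def
  proof (intro conjI ballI allI subsetI; clarsimp)
    show "(0,0) \<in> G" by fact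
    show "(x + y, 0) \<in> G" if "(x,0) \<in> G" "(y,0) \<in> G" for x y using p[OF that] by simp
    show "(scale1 k x, 0) \<in> G" if "(x,0) \<in> G" for k x using c[OF that, of k] by simp
    show "x \<in> V1" if "(x,0) \<in> G" for x using that GV by auto
    show "(act1 X x, 0) \<in> G" if "X \<in> sl3" "(x,0) \<in> G" for X x using m[OF that] that(1) by simp
  qed
  show "B.submodule {u. (0, u) \<in> G}"
    unfolding B.submodule_def B.subspace_def
  proof (intro conjI ballI allI subsetI; clarsimp)
    show "(0,0) \<in> G" by fact
    show "(0, x + y) \<in> G" if "(0,x) \<in> G" "(0,y) \<in> G" for x y using p[OF that] by simp
    show "(0, scale2 k x) \<in> G" if "(0,x) \<in> G" for k x using c[OF that, of k] by simp
    show "x \<in> V2" if "(0,x) \<in> G" for x using that GV by auto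
    show "(0, act2 X x) \<in> G" if "X \<in> sl3" "(0,x) \<in> G" for X x using m[OF that] that(1) by simp
  qed
qed

text \<open>A subspace of \<open>V1 \<times> V2\<close> meeting both factors trivially is the graph of an injective linear map
  between its projections.\<close>

lemma dim_graph:
  assumes G: "P.subspace G" and inj: "\<And>u. (u,0) \<in> G \<Longrightarrow> u = 0" "\<And>u. (0,u) \<in> G \<Longrightarrow> u = 0"
    and W: "A.subspace W" "W \<subseteq> fst ` G"
  shows "A.dim W = B.dim {u'. \<exists>u\<in>W. (u,u') \<in> G}"
proof -
  have s: "(u+v,u'+v') \<in> G" "(u-v,u'-v') \<in> G" if "(u,u') \<in> G" "(v,v') \<in> G" for u v u' v'
    using P.subspace_add[OF G that] P.subspace_diff[OF G that] by simp_all
  have sc: "(scale1 c u, scale2 c v) \<in> G" if "(u,v) \<in> G" for c u v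
    using P.subspace_scale[OF G that, of c] by (simp add: pair_scale_def)
  have z: "(0,0) \<in> G" using P.subspace_0[OF G] by (simp add: zero_prod_def)
  obtain B where B: "B \<subseteq> W" "A.independent B" "W \<subseteq> A.span B" "card B = A.dim W"
    using A.basis_exists by metis
  have "\<forall>u\<in>W. \<exists>u'. (u,u') \<in> G" using W by force
  then obtain f where f: "\<And>u. u \<in> W \<Longrightarrow> (u, f u) \<in> G" by metis
  obtain g where g: "Vector_Spaces.linear scale1 scale2 g" "\<And>u. u \<in> B \<Longrightarrow> g u = f u"
    using linear_independent_extend[OF B(2)] by metis
  interpret g: Vector_Spaces.linear scale1 scale2 g by (rule g(1))
  have gG: "(u, g u) \<in> G" if "u \<in> W" for u
  proof -
    have "u \<in> A.span B" using that B by auto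
    then show ?thesis
    proof (induction rule: A.span_induct_alt)
      case base
      then show ?case using z by (simp add: g.zero)
    next
      case (step c x y)
      then have "(x, g x) \<in> G" using f[of x] g(2)[of x] B(1) by auto
      then show ?case using s(1)[OF sc[of x "g x" c] step(2)] by (simp add: g.add g.scale)
    qed
  qed
  have uniq: "u' = g u" if "(u,u') \<in> G" "u \<in> W" for u u'
    using s(2)[OF that(1) gG[OF that(2)]] inj(2) by force
  have "{u'. \<exists>u\<in>W. (u,u') \<in> G} = g ` W" using gG uniq by auto
  moreover have inj_g: "inj_on g W"
  proof (rule inj_onI)
    fix x y assume "x \<in> W" "y \<in> W" "g x = g y"
    then show "x = y" using s(2)[OF gG[of x] gG[of y]] inj(1)[of "x - y"] by simp
  qed
  moreover have sB: "A.span B = W" using W(1) B by (metis A.span_minimal subset_antisym)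
  moreover have "card (g ` B) = A.dim W"
    using B(1,4) inj_g by (metis card_image inj_on_subset)
  moreover have "B.independent (g ` B)"
    using g.independent_injective_image[OF B(2)] inj_g sB by simp
  ultimately show ?thesis
    by (metis B(1) B.dim_unique g.span_image image_mono order_refl)
qed

text \<open>Let \<open>G\<close> be the submodule generated by \<open>(v1, v2)\<close>.  Its projections are nonzero submodules, hence
  everything.  Its intersections with the factors are submodules too, and they are not everything:
  \<open>(v1, 0)\<close> has the highest weight but is no multiple of \<open>(v1, v2)\<close>.  So they vanish.\<close>

theorem highest_weight_unique:
  assumes irr: "A.irreducible" "B.irreducible"
    and v1: "v1 \<in> A.wspace lam" "A.singular v1" "v1 \<noteq> 0"
    and v2: "v2 \<in> B.wspace lam" "B.singular v2" "v2 \<noteq> 0"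
  shows "A.dim V1 = B.dim V2" "A.dim (A.wspace \<mu>) = B.dim (B.wspace \<mu>)"
proof -
  have "(v1,v2) \<in> P.wspace lam" "P.singular (v1,v2)"
    using v1 v2 by (auto simp: P.wspace_def A.wspace_def B.wspace_def pair_act_def pair_scale_def
        P.singular_def A.singular_def B.singular_def zero_prod_def)
  then obtain G where G: "P.submodule G" "(v1,v2) \<in> G" and top:
    "\<And>u. u \<in> G \<Longrightarrow> pair_act coweight_rho u = pair_scale (weight_eval lam coweight_rho) u
      \<Longrightarrow> \<exists>c. u = pair_scale c (v1,v2)"
    by (rule P.highest_weight_submodule[of "(v1,v2)" lam]) blast
  note pr = graph_projections[OF G(1)]
  have w: "act1 coweight_rho v1 = scale1 (weight_eval lam coweight_rho) v1"
     "act2 coweight_rho v2 = scale2 (weight_eval lam coweight_rho) v2"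
    using v1 v2 coweight_rho_cartan by (auto simp: A.wspace_def B.wspace_def)
  have n1: "(v1, 0) \<notin> G" using top[of "(v1,0)"] w v1 v2 coweight_rho_cartan
    by (auto simp: pair_act_def pair_scale_def cartan_sl3)
  have n2: "(0, v2) \<notin> G" using top[of "(0,v2)"] w v1 v2 coweight_rho_cartan
    by (auto simp: pair_act_def pair_scale_def cartan_sl3)
  have V: "v1 \<in> V1" "v2 \<in> V2" using v1 v2 by (auto simp: A.wspace_def B.wspace_def)
  have I: "\<And>U. A.submodule U \<Longrightarrow> U = {0} \<or> U = V1" "\<And>U. B.submodule U \<Longrightarrow> U = {0} \<or> U = V2"
    using irr by (simp_all add: A.irreducible_def B.irreducible_def)
  have i1: "{u. (u, 0) \<in> G} = {0}" using I(1)[OF pr(3)] n1 V by auto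
  have i2: "{u. (0, u) \<in> G} = {0}" using I(2)[OF pr(4)] n2 V by auto
  have "v1 \<in> fst ` G" "v2 \<in> snd ` G" using G(2) by force+
  then have o1: "fst ` G = V1" and o2: "snd ` G = V2"
    using I(1)[OF pr(1)] I(2)[OF pr(2)] v1(3) v2(3) by auto
  have sG: "P.subspace G" using G by (simp add: P.submodule_def)
  have inj: "\<And>u. (u,0) \<in> G \<Longrightarrow> u = 0" "\<And>u. (0,u) \<in> G \<Longrightarrow> u = 0" using i1 i2 by auto
  have dg: "A.dim W = B.dim {u'. \<exists>u\<in>W. (u,u') \<in> G}" if "A.subspace W" "W \<subseteq> fst ` G" for W
    by (rule dim_graph[OF sG _ _ that]) (use inj in auto)
  have "{u'. \<exists>u\<in>V1. (u,u') \<in> G} = V2" using o1 o2 by force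
  then show "A.dim V1 = B.dim V2" using dg[OF A.subspace_V] o1 by simp
  have GV: "G \<subseteq> V1 \<times> V2" using G by (simp add: P.submodule_def)
  have cl: "(act1 H u - scale1 c u, act2 H u' - scale2 c u') \<in> G"
    if "H \<in> cartan" "(u,u') \<in> G" for H u u' c
  proof -
    have "pair_act H (u,u') - pair_scale c (u,u') \<in> G"
      using G(1) that cartan_sl3 unfolding P.submodule_def
      by (intro P.subspace_diff[OF sG] P.subspace_scale[OF sG]) auto
    then show ?thesis by (simp add: pair_act_def pair_scale_def)
  qed
  have "u \<in> A.wspace \<mu> \<longleftrightarrow> u' \<in> B.wspace \<mu>" if "(u,u') \<in> G" for u u'
  proof -
    have "act1 H u = scale1 (weight_eval \<mu> H) u \<longleftrightarrow> act2 H u' = scale2 (weight_eval \<mu> H) u'"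
      if H: "H \<in> cartan" for H
      using cl[OF H \<open>(u,u') \<in> G\<close>, of "weight_eval \<mu> H"] inj by (metis right_minus_eq)
    then show ?thesis using that GV by (auto simp: A.wspace_def B.wspace_def)
  qed
  moreover have "B.wspace \<mu> \<subseteq> snd ` G" unfolding o2 by (auto simp: B.wspace_def)
  ultimately have "{u'. \<exists>u\<in>A.wspace \<mu>. (u,u') \<in> G} = B.wspace \<mu>" by force
  moreover have "A.wspace \<mu> \<subseteq> fst ` G" unfolding o1 by (auto simp: A.wspace_def)
  ultimately show "A.dim (A.wspace \<mu>) = B.dim (B.wspace \<mu>)"
    using dg[OF A.subspace_wspace] by simp
qed

end

section \<open>Polynomials in two triples of variables as a module\<close>

text \<open>A polynomial is encoded by its coefficients with respect to the divided powers
  \<open>x\<^sup>m / m!\<close>.  In these coordinates differentiation is a mere shift and multiplication by a variable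
  carries the factor, so that every identity below holds for all functions on exponents, finitely
  supported or not.\<close>

type_synonym 'k coeffs = "('k \<Rightarrow> nat) \<Rightarrow> complex"

definition coeff_scale :: "complex \<Rightarrow> 'k coeffs \<Rightarrow> 'k coeffs" where
  "coeff_scale c f = (\<lambda>m. c * f m)"

global_interpretation co: vector_space coeff_scale
  by unfold_locales (auto simp: coeff_scale_def fun_eq_iff algebra_simps)

text \<open>\<open>der k\<close> is \<open>\<partial>/\<partial>x\<^sub>k\<close> and \<open>mul k\<close> is multiplication by \<open>x\<^sub>k\<close>.  In the latter, at an exponent with
  \<open>m k = 0\<close> the factor vanishes, so the truncated subtraction is harmless.\<close>

definition der :: "'k \<Rightarrow> 'k coeffs \<Rightarrow> 'k coeffs" where
  "der k f = (\<lambda>m. f (m(k := Suc (m k))))"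
definition mul :: "'k \<Rightarrow> 'k coeffs \<Rightarrow> 'k coeffs" where
  "mul k f = (\<lambda>m. of_nat (m k) * f (m(k := m k - 1)))"

text \<open>The defining relation of the Weyl algebra, from which all commutators below follow.\<close>

lemma der_mul: "der k (mul l f) = mul l (der k f) + (if k = l then f else 0)"
  by (auto simp: der_def mul_def fun_eq_iff fun_upd_twist algebra_simps
      split: nat_diff_split) (metis fun_upd_triv Suc_pred not_gr_zero)+

lemma der_der: "der k (der l f) = der l (der k f)"
  by (cases "k = l") (auto simp: der_def fun_eq_iff fun_upd_twist)

lemma mul_mul: "mul k (mul l f) = mul l (mul k f)"
  by (cases "k = l") (auto simp: mul_def fun_eq_iff fun_upd_twist)

lemma der_add: "der k (f + g) = der k f + der k g"
  and mul_add: "mul k (f + g) = mul k f + mul k g"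
  and der_zero: "der k 0 = 0" and mul_zero: "mul k 0 = 0"
  and der_diff: "der k (f - g) = der k f - der k g"
  and mul_diff: "mul k (f - g) = mul k f - mul k g"
  and der_scale: "der k (coeff_scale c f) = coeff_scale c (der k f)"
  and mul_scale: "mul k (coeff_scale c f) = coeff_scale c (mul k f)"
  by (auto simp: der_def mul_def coeff_scale_def fun_eq_iff algebra_simps)

text \<open>The vector field \<open>x\<^sub>k \<partial>/\<partial>x\<^sub>l\<close>.\<close>

definition xd :: "'k \<Rightarrow> 'k \<Rightarrow> 'k coeffs \<Rightarrow> 'k coeffs" where
  "xd k l f = mul k (der l f)"

lemma xd_xd: "xd k l (xd p q f) = mul k (mul p (der l (der q f))) + (if l = p then xd k q f else 0)"
  by (simp add: xd_def der_mul mul_add mul_zero)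

lemma xd_comm: "xd k l (xd p q f) - xd p q (xd k l f)
    = (if l = p then xd k q f else 0) - (if q = k then xd p l f else 0)"
  unfolding xd_xd by (simp add: mul_mul[of k p] der_der[of l q])

lemma der_xd: "der r (xd k l f) = xd k l (der r f) + (if r = k then der l f else 0)"
  by (simp add: xd_def der_mul der_der[of r l])

lemma xd_add: "xd k l (f + g) = xd k l f + xd k l g"
  and xd_diff: "xd k l (f - g) = xd k l f - xd k l g"
  and xd_zero: "xd k l 0 = 0"
  and xd_scale: "xd k l (coeff_scale c f) = coeff_scale c (xd k l f)"
  by (simp_all add: xd_def der_add mul_add der_diff mul_diff der_zero mul_zero der_scale mul_scale)

lemma xd_apply: "xd k l f m = of_nat (m k) * f ((m(k := m k - 1))(l := Suc ((m(k := m k - 1)) l)))"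
  by (simp add: xd_def der_def mul_def)

type_synonym monom = "3 + 3 \<Rightarrow> nat"

text \<open>The variables \<open>Inl i\<close> are coordinates on the defining representation and the variables \<open>Inr i\<close> on its
  dual; hence the reversed indices and the sign in the second term.\<close>

definition gl_unit :: "3 \<Rightarrow> 3 \<Rightarrow> (3 + 3) coeffs \<Rightarrow> (3 + 3) coeffs" where
  "gl_unit i j f = xd (Inl i) (Inl j) f - xd (Inr j) (Inr i) f"

lemma gl_unit_comm: "gl_unit i j (gl_unit k l f) - gl_unit k l (gl_unit i j f)
   = (if j = k then gl_unit i l f else 0) - (if i = l then gl_unit k j f else 0)"
proof -
  have "gl_unit i j (gl_unit k l f) - gl_unit k l (gl_unit i j f)
    = (xd (Inl i) (Inl j) (xd (Inl k) (Inl l) f) - xd (Inl k) (Inl l) (xd (Inl i) (Inl j) f))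
    - (xd (Inl i) (Inl j) (xd (Inr l) (Inr k) f) - xd (Inr l) (Inr k) (xd (Inl i) (Inl j) f))
    - (xd (Inr j) (Inr i) (xd (Inl k) (Inl l) f) - xd (Inl k) (Inl l) (xd (Inr j) (Inr i) f))
    + (xd (Inr j) (Inr i) (xd (Inr l) (Inr k) f) - xd (Inr l) (Inr k) (xd (Inr j) (Inr i) f))"
    by (simp add: gl_unit_def xd_diff)
  also have "\<dots> = (if j = k then gl_unit i l f else 0) - (if i = l then gl_unit k j f else 0)"
    unfolding xd_comm by (auto simp: gl_unit_def)
  finally show ?thesis .
qed

lemma gl_unit_linear: "gl_unit i j (f + g) = gl_unit i j f + gl_unit i j g"
  "gl_unit i j (coeff_scale c f) = coeff_scale c (gl_unit i j f)"
  "gl_unit i j 0 = 0"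
  by (simp_all add: gl_unit_def xd_add xd_scale xd_zero co.scale_right_diff_distrib)

lemma gl_unit_sum: "gl_unit i j (\<Sum>x\<in>S. h x) = (\<Sum>x\<in>S. gl_unit i j (h x))"
  by (induction S rule: infinite_finite_induct)
    (simp_all only: sum.empty sum.insert sum.infinite gl_unit_linear not_False_eq_True)

definition gl_act :: "complex^3^3 \<Rightarrow> (3 + 3) coeffs \<Rightarrow> (3 + 3) coeffs" where
  "gl_act A f = (\<Sum>i\<in>UNIV. \<Sum>j\<in>UNIV. coeff_scale (A $ i $ j) (gl_unit i j f))"

lemma gl_act_add: "gl_act A (f + g) = gl_act A f + gl_act A g"
  and gl_act_scale: "gl_act A (coeff_scale c f) = coeff_scale c (gl_act A f)"
  and gl_act_mat_add: "gl_act (A + B) f = gl_act A f + gl_act B f"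
  and gl_act_mat_scale: "gl_act (mat_scale c A) f = coeff_scale c (gl_act A f)"
  by (simp_all add: gl_act_def gl_unit_linear sum.distrib co.scale_right_distrib
      co.scale_left_distrib co.scale_sum_right co.scale_left_commute mat_scale_def mult.commute)

lemma sum_swap_pairs:
  fixes h :: "3 \<Rightarrow> 3 \<Rightarrow> 3 \<Rightarrow> 3 \<Rightarrow> 'a::comm_monoid_add"
  shows "(\<Sum>i\<in>UNIV. \<Sum>j\<in>UNIV. \<Sum>k\<in>UNIV. \<Sum>l\<in>UNIV. h i j k l)
       = (\<Sum>k\<in>UNIV. \<Sum>l\<in>UNIV. \<Sum>i\<in>UNIV. \<Sum>j\<in>UNIV. h i j k l)"
proof -
  have p: "(\<Sum>i\<in>UNIV. \<Sum>j\<in>UNIV. F i j) = (\<Sum>p\<in>UNIV\<times>UNIV. F (fst p) (snd p))"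
    for F :: "3 \<Rightarrow> 3 \<Rightarrow> 'a"
    by (simp add: sum.cartesian_product split_def del: UNIV_Times_UNIV)
  show ?thesis unfolding p by (rule sum.swap)
qed

lemma gl_act_bracket: "gl_act (lie_bracket A B) f = gl_act A (gl_act B f) - gl_act B (gl_act A f)"
proof -
  let ?s = coeff_scale
  have AB: "gl_act A (gl_act B f) = (\<Sum>i\<in>UNIV. \<Sum>j\<in>UNIV. \<Sum>k\<in>UNIV. \<Sum>l\<in>UNIV.
      ?s (A$i$j * B$k$l) (gl_unit i j (gl_unit k l f)))" for A B
    by (simp add: gl_act_def gl_unit_sum gl_unit_linear co.scale_sum_right)
  have BA: "gl_act B (gl_act A f) = (\<Sum>i\<in>UNIV. \<Sum>j\<in>UNIV. \<Sum>k\<in>UNIV. \<Sum>l\<in>UNIV.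
      ?s (A$i$j * B$k$l) (gl_unit k l (gl_unit i j f)))"
    unfolding AB by (subst sum_swap_pairs) (simp only: mult.commute)
  have "gl_act A (gl_act B f) - gl_act B (gl_act A f)
     = (\<Sum>i\<in>UNIV. \<Sum>j\<in>UNIV. \<Sum>k\<in>UNIV. \<Sum>l\<in>UNIV. ?s (A$i$j * B$k$l)
        (gl_unit i j (gl_unit k l f) - gl_unit k l (gl_unit i j f)))"
    unfolding BA unfolding AB by (simp add: sum_subtractf co.scale_right_diff_distrib)
  also have "\<dots> = (\<Sum>i\<in>UNIV. \<Sum>j\<in>UNIV. \<Sum>k\<in>UNIV. \<Sum>l\<in>UNIV. if j = k then ?s (A$i$j * B$k$l) (gl_unit i l f) else 0)
     - (\<Sum>i\<in>UNIV. \<Sum>j\<in>UNIV. \<Sum>k\<in>UNIV. \<Sum>l\<in>UNIV. if i = l then ?s (A$i$j * B$k$l) (gl_unit k j f) else 0)"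
    unfolding gl_unit_comm
    by (simp add: sum_subtractf co.scale_right_diff_distrib if_distrib[of "?s _"] cong: if_cong)
  also have "(\<Sum>i\<in>UNIV. \<Sum>j\<in>UNIV. \<Sum>k\<in>UNIV. \<Sum>l\<in>UNIV. if j = k then ?s (A$i$j * B$k$l) (gl_unit i l f) else 0)
     = gl_act (A ** B) f"
  proof -
    have d: "(\<Sum>k\<in>UNIV. \<Sum>l\<in>UNIV. if j = k then g k l else 0) = (\<Sum>l\<in>UNIV. g j l)"
      for j :: 3 and g :: "3 \<Rightarrow> 3 \<Rightarrow> (3 + 3) coeffs"
      by (subst sum.swap) simp
    have "(\<Sum>j\<in>UNIV. \<Sum>l\<in>UNIV. ?s (A$i$j * B$j$l) (gl_unit i l f))
      = (\<Sum>l\<in>UNIV. ?s ((A ** B)$i$l) (gl_unit i l f))" for i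
      by (subst sum.swap) (simp add: matrix_matrix_mult_def co.scale_sum_left)
    then show ?thesis unfolding d gl_act_def by simp
  qed
  also have "(\<Sum>i\<in>UNIV. \<Sum>j\<in>UNIV. \<Sum>k\<in>UNIV. \<Sum>l\<in>UNIV. if i = l then ?s (A$i$j * B$k$l) (gl_unit k j f) else 0)
     = gl_act (B ** A) f"
  proof -
    have "(\<Sum>i\<in>UNIV. \<Sum>j\<in>UNIV. \<Sum>k\<in>UNIV. ?s (A$i$j * B$k$i) (gl_unit k j f))
      = (\<Sum>k\<in>UNIV. \<Sum>j\<in>UNIV. \<Sum>i\<in>UNIV. ?s (A$i$j * B$k$i) (gl_unit k j f))"
      (is "(\<Sum>i\<in>UNIV. \<Sum>j\<in>UNIV. \<Sum>k\<in>UNIV. ?g i j k) = _")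
    proof -
      have "(\<Sum>i\<in>UNIV. \<Sum>j\<in>UNIV. \<Sum>k\<in>UNIV. ?g i j k) = (\<Sum>j\<in>UNIV. \<Sum>i\<in>UNIV. \<Sum>k\<in>UNIV. ?g i j k)"
        by (rule sum.swap)
      also have "\<dots> = (\<Sum>j\<in>UNIV. \<Sum>k\<in>UNIV. \<Sum>i\<in>UNIV. ?g i j k)"
        by (rule sum.cong[OF HOL.refl], rule sum.swap)
      also have "\<dots> = (\<Sum>k\<in>UNIV. \<Sum>j\<in>UNIV. \<Sum>i\<in>UNIV. ?g i j k)"
        by (rule sum.swap)
      finally show ?thesis .
    qed
    then show ?thesis by (simp add: gl_act_def matrix_matrix_mult_def co.scale_sum_left mult.commute)
  qed
  also have "gl_act (A ** B) f - gl_act (B ** A) f = gl_act (lie_bracket A B) f"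
    by (simp add: gl_act_def lie_bracket_def sum_subtractf co.scale_left_diff_distrib)
  finally show ?thesis ..
qed

text \<open>The second order operator dual to multiplication by the invariant \<open>x\<^sub>1 y\<^sub>1 + x\<^sub>2 y\<^sub>2 + x\<^sub>3 y\<^sub>3\<close>.\<close>

definition laplace :: "(3 + 3) coeffs \<Rightarrow> (3 + 3) coeffs" where
  "laplace f = (\<Sum>i\<in>UNIV. der (Inl i) (der (Inr i) f))"

text \<open>The two vector fields in \<open>gl_unit i j\<close> contribute the same second derivative with opposite signs.\<close>

lemma laplace_gl_unit: "laplace (gl_unit i j f) = gl_unit i j (laplace f)"
proof -
  have "der (Inl k) (der (Inr k) (gl_unit i j f)) = gl_unit i j (der (Inl k) (der (Inr k) f))
      + ((if k = i then der (Inl j) (der (Inr i) f) else 0) - (if k = j then der (Inl j) (der (Inr i) f) else 0))" for k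
    by (simp add: gl_unit_def der_diff der_xd der_add der_zero)
  then show ?thesis by (simp add: laplace_def gl_unit_sum sum.distrib sum_subtractf)
qed

section \<open>Harmonic polynomials and their reduced monomials\<close>

definition degL :: "monom \<Rightarrow> nat" where "degL m = m (Inl 1) + m (Inl 2) + m (Inl 3)"
definition degR :: "monom \<Rightarrow> nat" where "degR m = m (Inr 1) + m (Inr 2) + m (Inr 3)"

text \<open>The weight of a monomial, in the coordinates of 3-space but not projected to the plane of coordinate
  sum 0.  Only differences of these numbers matter.\<close>

definition wt :: "3 \<Rightarrow> monom \<Rightarrow> int" where "wt i m = int (m (Inl i)) - int (m (Inr i))"

definition harmonic :: "nat \<Rightarrow> nat \<Rightarrow> (3 + 3) coeffs set" where
  "harmonic a b = {f. (\<forall>m. f m \<noteq> 0 \<longrightarrow> degL m = a \<and> degR m = b) \<and> laplace f = 0}"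

text \<open>Multiplication of a monomial by \<open>x\<^sub>i y\<^sub>i\<close>, and division by it.  In divided power coordinates the
  Laplacian is the sum of the shifts along \<open>up i\<close>.\<close>

definition up :: "3 \<Rightarrow> monom \<Rightarrow> monom" where
  "up i m = m(Inl i := Suc (m (Inl i)), Inr i := Suc (m (Inr i)))"

definition down :: "3 \<Rightarrow> monom \<Rightarrow> monom" where
  "down i m = m(Inl i := m (Inl i) - 1, Inr i := m (Inr i) - 1)"

lemma laplace_apply: "laplace f m = f (up 1 m) + f (up 2 m) + f (up 3 m)"
  by (simp add: laplace_def sum_3 der_def up_def)

lemma down_up: "down i (up i m) = m"
  by (simp add: up_def down_def fun_eq_iff)

lemma up_down: "m (Inl i) \<noteq> 0 \<Longrightarrow> m (Inr i) \<noteq> 0 \<Longrightarrow> up i (down i m) = m"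
  by (simp add: up_def down_def fun_eq_iff)

lemma laplace_linear: "laplace (f + g) = laplace f + laplace g"
  "laplace (coeff_scale c f) = coeff_scale c (laplace f)" "laplace 0 = 0"
  by (simp_all add: laplace_apply fun_eq_iff coeff_scale_def algebra_simps)

lemma laplace_sum: "laplace (\<Sum>x\<in>S. h x) = (\<Sum>x\<in>S. laplace (h x))"
  by (induction S rule: infinite_finite_induct)
    (simp_all only: sum.empty sum.insert sum.infinite laplace_linear not_False_eq_True)

lemma sum_apply: "(\<Sum>x\<in>S. (h x :: 'b \<Rightarrow> complex)) m = (\<Sum>x\<in>S. h x m)"
  by (induction S rule: infinite_finite_induct) simp_all

lemma subspace_harmonic: "co.subspace (harmonic a b)"
  unfolding co.subspace_def harmonic_def
proof (intro conjI ballI allI; (elim CollectE conjE)?)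
  show "0 \<in> {f. (\<forall>m. f m \<noteq> 0 \<longrightarrow> degL m = a \<and> degR m = b) \<and> laplace f = 0}"
    by (auto simp: laplace_linear(3))
next
  fix f g assume h: "\<forall>m. f m \<noteq> 0 \<longrightarrow> degL m = a \<and> degR m = b" "laplace f = 0"
    "\<forall>m. g m \<noteq> 0 \<longrightarrow> degL m = a \<and> degR m = b" "laplace g = 0"
  have "f m \<noteq> 0 \<or> g m \<noteq> 0" if "(f + g) m \<noteq> 0" for m using that by auto
  then show "f + g \<in> {f. (\<forall>m. f m \<noteq> 0 \<longrightarrow> degL m = a \<and> degR m = b) \<and> laplace f = 0}"
    using h by (simp only: laplace_linear mem_Collect_eq) auto
next
  fix c f assume h: "\<forall>m. f m \<noteq> 0 \<longrightarrow> degL m = a \<and> degR m = b" "laplace f = 0"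
  then show "coeff_scale c f \<in> {f. (\<forall>m. f m \<noteq> 0 \<longrightarrow> degL m = a \<and> degR m = b) \<and> laplace f = 0}"
    by (simp only: laplace_linear mem_Collect_eq) (auto simp: coeff_scale_def)
qed

lemma xd_support_L:
  assumes "xd (Inl i) (Inl j) f m \<noteq> 0"
  obtains m' where "f m' \<noteq> 0" "degL m' = degL m" "degR m' = degR m"
    "wt 1 m' - wt 3 m' = wt 1 m - wt 3 m - (of_bool (i=1) - of_bool (i=3)) + (of_bool (j=1) - of_bool (j=3))"
proof
  let ?m = "(m(Inl i := m (Inl i) - 1))(Inl j := Suc ((m(Inl i := m (Inl i) - 1)) (Inl j)))"
  have nz: "m (Inl i) \<noteq> 0" using assms by (auto simp: xd_apply)
  show "f ?m \<noteq> 0" using assms by (auto simp: xd_apply)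
  show "degL ?m = degL m" "degR ?m = degR m"
    "wt 1 ?m - wt 3 ?m = wt 1 m - wt 3 m - (of_bool (i=1) - of_bool (i=3)) + (of_bool (j=1) - of_bool (j=3))"
    using nz exhaust_3[of i] exhaust_3[of j] by (auto simp: degL_def degR_def wt_def of_nat_diff)
qed

lemma xd_support_R:
  assumes "xd (Inr i) (Inr j) f m \<noteq> 0"
  obtains m' where "f m' \<noteq> 0" "degL m' = degL m" "degR m' = degR m"
    "wt 1 m' - wt 3 m' = wt 1 m - wt 3 m + (of_bool (i=1) - of_bool (i=3)) - (of_bool (j=1) - of_bool (j=3))"
proof
  let ?m = "(m(Inr i := m (Inr i) - 1))(Inr j := Suc ((m(Inr i := m (Inr i) - 1)) (Inr j)))"
  have nz: "m (Inr i) \<noteq> 0" using assms by (auto simp: xd_apply)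
  show "f ?m \<noteq> 0" using assms by (auto simp: xd_apply)
  show "degL ?m = degL m" "degR ?m = degR m"
    "wt 1 ?m - wt 3 ?m = wt 1 m - wt 3 m + (of_bool (i=1) - of_bool (i=3)) - (of_bool (j=1) - of_bool (j=3))"
    using nz exhaust_3[of i] exhaust_3[of j] by (auto simp: degL_def degR_def wt_def of_nat_diff)
qed

text \<open>A matrix unit changes the height of weights by a fixed amount.  The height of the source is
  stated in terms of that of the target because coefficients are pulled back.\<close>

lemma gl_unit_support:
  assumes "gl_unit i j f m \<noteq> 0"
  obtains m' where "f m' \<noteq> 0" "degL m' = degL m" "degR m' = degR m"
    "wt 1 m' - wt 3 m' = wt 1 m - wt 3 m - (of_bool (i=1) - of_bool (i=3)) + (of_bool (j=1) - of_bool (j=3))"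
proof -
  have "xd (Inl i) (Inl j) f m \<noteq> 0 \<or> xd (Inr j) (Inr i) f m \<noteq> 0"
    using assms by (auto simp: gl_unit_def)
  then show thesis
    using that xd_support_L xd_support_R by (metis (no_types, lifting) diff_add_eq)
qed

lemma gl_unit_harmonic: "f \<in> harmonic a b \<Longrightarrow> gl_unit i j f \<in> harmonic a b"
  unfolding harmonic_def mem_Collect_eq laplace_gl_unit
  by (auto simp: gl_unit_linear(3) elim!: gl_unit_support)

lemma gl_act_harmonic: "f \<in> harmonic a b \<Longrightarrow> gl_act A f \<in> harmonic a b"
  unfolding gl_act_def
  by (intro co.subspace_sum[OF subspace_harmonic] co.subspace_scale[OF subspace_harmonic] gl_unit_harmonic)

global_interpretation harm: sl3_rep_on coeff_scale "harmonic a b" gl_act for a b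
  by unfold_locales
    (simp_all add: subspace_harmonic gl_act_harmonic gl_act_add gl_act_scale gl_act_mat_add
      gl_act_mat_scale gl_act_bracket)

text \<open>Solving the Laplace equation at \<open>m / (x\<^sub>2 y\<^sub>2)\<close> for the coefficient at \<open>m\<close> lowers the exponent of
  \<open>x\<^sub>2\<close>, so prescribed coefficients at the monomials not divisible by \<open>x\<^sub>2 y\<^sub>2\<close> extend, and by the same
  induction uniquely (\<open>harmonic_zero\<close>).\<close>

function extend :: "(3 + 3) coeffs \<Rightarrow> (3 + 3) coeffs" where
  "extend g m = (if m (Inl 2) = 0 \<or> m (Inr 2) = 0 then g m
     else - extend g (up 1 (down 2 m)) - extend g (up 3 (down 2 m)))"
  by auto
termination
  by (relation "Wellfounded.measure (\<lambda>(g, m). m (Inl 2))") (auto simp: up_def down_def)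

declare extend.simps [simp del]

definition reduced :: "monom \<Rightarrow> bool" where "reduced m \<longleftrightarrow> m (Inl 2) = 0 \<or> m (Inr 2) = 0"

lemma extend_reduced: "reduced m \<Longrightarrow> extend g m = g m"
  by (subst extend.simps) (auto simp: reduced_def)

lemma extend_not_reduced:
  "\<not> reduced m \<Longrightarrow> extend g m = - extend g (up 1 (down 2 m)) - extend g (up 3 (down 2 m))"
  by (subst extend.simps) (auto simp: reduced_def)

lemma laplace_extend: "laplace (extend g) = 0"
proof
  fix m
  have "\<not> reduced (up 2 m)" by (simp add: reduced_def up_def)
  from extend_not_reduced[OF this, of g] show "laplace (extend g) m = 0 m"
    by (simp add: laplace_apply down_up)
qed

lemma move_invariants:
  assumes "\<not> reduced m"
  shows "degL (up i (down 2 m)) = degL m" "degR (up i (down 2 m)) = degR m" "wt j (up i (down 2 m)) = wt j m"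
  using assms exhaust_3[of i] exhaust_3[of j]
  by (auto simp: reduced_def up_def down_def degL_def degR_def wt_def of_nat_diff)

definition harm_basis :: "monom \<Rightarrow> (3 + 3) coeffs" where
  "harm_basis n = extend (\<lambda>m. if m = n then 1 else 0)"

lemma harm_basis_support:
  "harm_basis n m \<noteq> 0 \<Longrightarrow> degL m = degL n \<and> degR m = degR n \<and> (\<forall>j. wt j m = wt j n)"
proof (induction "m (Inl 2)" arbitrary: m rule: less_induct)
  case less
  show ?case
  proof (cases "reduced m")
    case True
    then show ?thesis using less.prems by (auto simp: harm_basis_def extend_reduced split: if_splits)
  next
    case False
    have lt: "up i (down 2 m) (Inl 2) < m (Inl 2)" if "i \<noteq> 2" for i
      using False that by (auto simp: up_def down_def reduced_def)
    have "harm_basis n (up 1 (down 2 m)) \<noteq> 0 \<or> harm_basis n (up 3 (down 2 m)) \<noteq> 0"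
      using less.prems False by (auto simp: harm_basis_def extend_not_reduced)
    then show ?thesis
      using less.hyps[of "up 1 (down 2 m)"] less.hyps[of "up 3 (down 2 m)"] lt[of 1] lt[of 3]
        move_invariants[OF False] by auto
  qed
qed

lemma harmonic_zero:
  assumes "laplace f = 0" "\<And>m. reduced m \<Longrightarrow> f m = 0"
  shows "f = 0"
proof
  fix m show "f m = 0 m"
  proof (induction "m (Inl 2)" arbitrary: m rule: less_induct)
    case less
    show ?case
    proof (cases "reduced m")
      case False
      have "laplace f (down 2 m) = 0" using assms(1) by simp
      then have "f (up 1 (down 2 m)) + f m + f (up 3 (down 2 m)) = 0"
        using False by (simp add: laplace_apply reduced_def up_down)
      moreover have "f (up 1 (down 2 m)) = 0" "f (up 3 (down 2 m)) = 0"
        using False less by (simp_all add: up_def down_def reduced_def)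
      ultimately show ?thesis by simp
    qed (simp add: assms(2))
  qed
qed

text \<open>The predicate selects weights by their coordinates in the basis of fundamental weights; the trivial
  predicate gives the whole module and a single point gives a weight space.\<close>

definition harm_sub :: "nat \<Rightarrow> nat \<Rightarrow> (int \<Rightarrow> int \<Rightarrow> bool) \<Rightarrow> (3 + 3) coeffs set" where
  "harm_sub a b R = {f \<in> harmonic a b. \<forall>m. f m \<noteq> 0 \<longrightarrow> R (wt 1 m - wt 2 m) (wt 2 m - wt 3 m)}"

definition index_set :: "nat \<Rightarrow> nat \<Rightarrow> (int \<Rightarrow> int \<Rightarrow> bool) \<Rightarrow> monom set" where
  "index_set a b R = {m. degL m = a \<and> degR m = b \<and> reduced m \<and> R (wt 1 m - wt 2 m) (wt 2 m - wt 3 m)}"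

lemma finite_degrees: "finite {m. degL m = a \<and> degR m = b}"
proof -
  have "finite (UNIV \<rightarrow>\<^sub>E {..a+b} :: monom set)" by (rule finite_PiE) auto
  moreover have "m k \<le> a + b" if "degL m = a" "degR m = b" for m and k :: "3 + 3"
  proof (cases k)
    case (Inl i)
    then show ?thesis using that exhaust_3[of i] by (auto simp: degL_def degR_def)
  next
    case (Inr i)
    then show ?thesis using that exhaust_3[of i] by (auto simp: degL_def degR_def)
  qed
  ultimately show ?thesis by (elim finite_subset[rotated]) (auto simp: PiE_def)
qed

lemma finite_index_set: "finite (index_set a b R)"
  by (rule finite_subset[OF _ finite_degrees[of a b]]) (auto simp: index_set_def)

lemma harm_basis_reduced: "reduced m \<Longrightarrow> harm_basis n m = (if m = n then 1 else 0)"
  by (simp add: harm_basis_def extend_reduced)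

lemma harm_basis_mem: "n \<in> index_set a b R \<Longrightarrow> harm_basis n \<in> harm_sub a b R"
  using harm_basis_support[of n] by (auto simp: harm_sub_def harmonic_def index_set_def harm_basis_def laplace_extend)

text \<open>Both sides are harmonic and agree at the reduced monomials.\<close>

lemma harm_sub_expansion:
  assumes "f \<in> harm_sub a b R"
  shows "f = (\<Sum>n\<in>index_set a b R. coeff_scale (f n) (harm_basis n))"
proof -
  let ?g = "f - (\<Sum>n\<in>index_set a b R. coeff_scale (f n) (harm_basis n))"
  have lap: "laplace (harm_basis n) = 0" for n by (simp add: harm_basis_def laplace_extend)
  have "laplace (?g + (\<Sum>n\<in>index_set a b R. coeff_scale (f n) (harm_basis n))) = 0"
    using assms by (simp add: harm_sub_def harmonic_def)
  then have "laplace ?g = 0"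
    unfolding laplace_linear laplace_sum lap by simp
  moreover have "?g m = 0" if m: "reduced m" for m
  proof -
    have "(\<Sum>n\<in>index_set a b R. coeff_scale (f n) (harm_basis n)) m
      = (\<Sum>n\<in>index_set a b R. if n = m then f n else 0)"
      unfolding sum_apply coeff_scale_def by (intro sum.cong) (auto simp: harm_basis_reduced m)
    also have "\<dots> = (if m \<in> index_set a b R then f m else 0)"
      by (simp add: finite_index_set)
    also have "\<dots> = f m"
      using assms m by (auto simp: harm_sub_def harmonic_def index_set_def)
    finally show ?thesis by simp
  qed
  ultimately have "?g = 0" by (rule harmonic_zero)
  then show ?thesis by simp
qed

lemma harm_sub_dim: "co.dim (harm_sub a b R) = card (index_set a b R)"
  and harm_sub_span: "harm_sub a b R \<subseteq> co.span (harm_basis ` index_set a b R)"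
proof -
  let ?X = "index_set a b R"
  have inj: "inj_on harm_basis ?X"
  proof (rule inj_onI)
    fix x y assume "x \<in> ?X" "y \<in> ?X" "harm_basis x = harm_basis y"
    then show "x = y"
      using harm_basis_reduced[of x x] harm_basis_reduced[of x y]
      by (auto simp: index_set_def split: if_splits)
  qed
  show span: "harm_sub a b R \<subseteq> co.span (harm_basis ` ?X)"
  proof
    fix f assume "f \<in> harm_sub a b R"
    from harm_sub_expansion[OF this] show "f \<in> co.span (harm_basis ` ?X)"
      by (elim ssubst) (intro co.span_sum co.span_scale co.span_base imageI)
  qed
  have "co.independent (harm_basis ` ?X)"
  proof (rule co.independent_if_scalars_zero)
    show "finite (harm_basis ` ?X)" by (simp add: finite_index_set)
    fix u x assume z: "(\<Sum>x\<in>harm_basis ` ?X. coeff_scale (u x) x) = 0" and "x \<in> harm_basis ` ?X"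
    then obtain n where n: "n \<in> ?X" "x = harm_basis n" by auto
    have "0 = (\<Sum>k\<in>?X. coeff_scale (u (harm_basis k)) (harm_basis k)) n"
      using z by (simp add: sum.reindex[OF inj])
    also have "\<dots> = (\<Sum>k\<in>?X. if k = n then u (harm_basis k) else 0)"
      unfolding sum_apply coeff_scale_def
      by (intro sum.cong) (use n in \<open>auto simp: harm_basis_reduced index_set_def\<close>)
    also have "\<dots> = u x" using n by (simp add: finite_index_set)
    finally show "u x = 0" by simp
  qed
  then show "co.dim (harm_sub a b R) = card ?X"
    using span inj by (intro co.dim_unique[of "harm_basis ` ?X"]) (auto simp: harm_basis_mem card_image)
qed

section \<open>Weights and singular vectors of harmonic polynomials\<close>

lemma xd_diag: "xd k k f m = of_nat (m k) * f m"
  by (cases "m k") (auto simp: xd_apply fun_upd_idem)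

text \<open>Monomials are weight vectors: the diagonal operators \<open>x\<^sub>i \<partial>/\<partial>x\<^sub>i - y\<^sub>i \<partial>/\<partial>y\<^sub>i\<close> multiply them by the
  difference of the exponents.\<close>

lemma gl_act_cartan:
  assumes "H \<in> cartan"
  shows "gl_act H f m = (\<Sum>i\<in>UNIV. H$i$i * of_int (wt i m)) * f m"
proof -
  have "coeff_scale (H$i$j) (gl_unit i j f) m = (if i = j then H$i$i * of_int (wt i m) * f m else 0)" for i j
    using assms by (auto simp: coeff_scale_def cartan_def gl_unit_def xd_diag wt_def algebra_simps)
  then show ?thesis by (simp add: gl_act_def sum_apply sum_distrib_right)
qed

lemma wspace_harmonic:
  assumes "\<mu> $ 1 - \<mu> $ 2 = of_int p" "\<mu> $ 2 - \<mu> $ 3 = of_int q"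
  shows "harm.wspace a b \<mu> = harm_sub a b (\<lambda>x y. x = p \<and> y = q)"
proof -
  have "(\<forall>H\<in>cartan. gl_act H f = coeff_scale (weight_eval \<mu> H) f) \<longleftrightarrow>
     (\<forall>m. f m \<noteq> 0 \<longrightarrow> wt 1 m - wt 2 m = p \<and> wt 2 m - wt 3 m = q)" (is "?L \<longleftrightarrow> ?R") for f
  proof
    assume L: ?L
    have e: "(\<Sum>i\<in>UNIV. H$i$i * of_int (wt i m)) = weight_eval \<mu> H" if "H \<in> cartan" "f m \<noteq> 0" for H m
    proof -
      have "gl_act H f m = weight_eval \<mu> H * f m"
        using L that(1) by (simp add: coeff_scale_def)
      then show ?thesis using that by (simp add: gl_act_cartan)
    qed
    show ?R
    proof (intro allI impI)
      fix m assume m: "f m \<noteq> 0"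
      let ?H1 = "mat_unit 1 1 - mat_unit 2 2" and ?H2 = "mat_unit 2 2 - mat_unit 3 3"
      have "?H1 \<in> cartan" "?H2 \<in> cartan"
        by (simp_all add: cartan_def sl3_def trace_def mat_unit_def forall_3 sum_3)
      from e[OF this(1) m] e[OF this(2) m]
      have "of_int (wt 1 m - wt 2 m) = complex_of_real (\<mu> $ 1 - \<mu> $ 2)"
        "of_int (wt 2 m - wt 3 m) = complex_of_real (\<mu> $ 2 - \<mu> $ 3)"
        by (simp_all add: sum_3 mat_unit_def weight_eval_def)
      then show "wt 1 m - wt 2 m = p \<and> wt 2 m - wt 3 m = q"
        unfolding assms by (metis of_int_eq_iff of_real_of_int_eq)
    qed
  next
    assume R: ?R
    show ?L
    proof (intro ballI ext)
      fix H m assume H: "H \<in> cartan"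
      show "gl_act H f m = coeff_scale (weight_eval \<mu> H) f m"
      proof (cases "f m = 0")
        case False
        have t: "H$3$3 = - H$1$1 - H$2$2"
          using H by (simp add: cartan_def sl3_def trace_def sum_3 add_eq_0_iff)
        have "wt 1 m = p + q + wt 3 m" "wt 2 m = q + wt 3 m" using R False by auto
        moreover have "\<mu> $ 1 = of_int p + of_int q + \<mu> $ 3" "\<mu> $ 2 = of_int q + \<mu> $ 3" using assms by auto
        ultimately have "(\<Sum>i\<in>UNIV. H$i$i * of_int (wt i m)) = weight_eval \<mu> H"
          by (simp add: sum_3 weight_eval_def t algebra_simps)
        then show ?thesis by (simp add: gl_act_cartan[OF H] coeff_scale_def)
      qed (simp add: gl_act_cartan[OF H] coeff_scale_def)
    qed
  qed
  then show ?thesis by (auto simp: harm.wspace_def harm_sub_def)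
qed

lemma gl_act_unit: "gl_act (mat_unit i j) f = gl_unit i j f"
proof -
  have "coeff_scale (mat_unit i j $ k $ l) (gl_unit k l f) = (if l = j then if k = i then gl_unit i j f else 0 else 0)" for k l
    by (auto simp: mat_unit_def)
  then show ?thesis by (simp add: gl_act_def)
qed

definition monom6 :: "nat \<Rightarrow> nat \<Rightarrow> nat \<Rightarrow> nat \<Rightarrow> nat \<Rightarrow> nat \<Rightarrow> monom" where
  "monom6 x1 x2 x3 y1 y2 y3 = case_sum (\<lambda>i. if i = 1 then x1 else if i = 2 then x2 else x3)
     (\<lambda>i. if i = 1 then y1 else if i = 2 then y2 else y3)"

lemma monom6_apply [simp]:
  "monom6 x1 x2 x3 y1 y2 y3 (Inl 1) = x1" "monom6 x1 x2 x3 y1 y2 y3 (Inl 2) = x2"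
  "monom6 x1 x2 x3 y1 y2 y3 (Inl 3) = x3" "monom6 x1 x2 x3 y1 y2 y3 (Inr 1) = y1"
  "monom6 x1 x2 x3 y1 y2 y3 (Inr 2) = y2" "monom6 x1 x2 x3 y1 y2 y3 (Inr 3) = y3"
  by (simp_all add: monom6_def)

lemma monom_ext:
  assumes "m (Inl 1) = m' (Inl 1)" "m (Inl 2) = m' (Inl 2)" "m (Inl 3) = m' (Inl 3)"
    "m (Inr 1) = m' (Inr 1)" "m (Inr 2) = m' (Inr 2)" "m (Inr 3) = m' (Inr 3)"
  shows "(m :: monom) = m'"
proof
  fix k :: "3 + 3"
  show "m k = m' k"
  proof (cases k)
    case (Inl i)
    then show ?thesis using assms exhaust_3[of i] by auto
  next
    case (Inr i)
    then show ?thesis using assms exhaust_3[of i] by auto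
  qed
qed

lemma monom6_collapse: "monom6 (m (Inl 1)) (m (Inl 2)) (m (Inl 3)) (m (Inr 1)) (m (Inr 2)) (m (Inr 3)) = m"
  by (rule monom_ext) simp_all

lemma monom6_upd [simp]:
  "(monom6 x1 x2 x3 y1 y2 y3)(Inl 1 := n) = monom6 n x2 x3 y1 y2 y3"
  "(monom6 x1 x2 x3 y1 y2 y3)(Inl 2 := n) = monom6 x1 n x3 y1 y2 y3"
  "(monom6 x1 x2 x3 y1 y2 y3)(Inl 3 := n) = monom6 x1 x2 n y1 y2 y3"
  "(monom6 x1 x2 x3 y1 y2 y3)(Inr 1 := n) = monom6 x1 x2 x3 n y2 y3"
  "(monom6 x1 x2 x3 y1 y2 y3)(Inr 2 := n) = monom6 x1 x2 x3 y1 n y3"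
  "(monom6 x1 x2 x3 y1 y2 y3)(Inr 3 := n) = monom6 x1 x2 x3 y1 y2 n"
  by (rule monom_ext; simp)+

lemma degL_monom6 [simp]: "degL (monom6 x1 x2 x3 y1 y2 y3) = x1 + x2 + x3"
  and degR_monom6 [simp]: "degR (monom6 x1 x2 x3 y1 y2 y3) = y1 + y2 + y3"
  by (simp_all add: degL_def degR_def)

text \<open>This is \<open>x\<^sub>1\<^sup>a y\<^sub>3\<^sup>b\<close> up to a scalar.\<close>

definition top_vector :: "nat \<Rightarrow> nat \<Rightarrow> (3 + 3) coeffs" where
  "top_vector a b = harm_basis (monom6 a 0 0 0 0 b)"

lemma top_reduced: "reduced (monom6 a 0 0 0 0 b)" by (simp add: reduced_def)

lemma top_vector_nz: "top_vector a b \<noteq> 0"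
  using harm_basis_reduced[OF top_reduced[of a b]] unfolding top_vector_def
  by (metis zero_fun_apply zero_neq_one)

lemma top_vector_mem: "top_vector a b \<in> harm_sub a b (\<lambda>x y. x = int a \<and> y = int b)"
  unfolding top_vector_def
  by (rule harm_basis_mem) (simp add: index_set_def top_reduced wt_def)

lemma height_bound: "degL m = a \<Longrightarrow> degR m = b \<Longrightarrow> wt 1 m - wt 3 m \<le> int a + int b"
  "degL m = a \<Longrightarrow> degR m = b \<Longrightarrow> wt 1 m - wt 3 m \<ge> - (int a + int b)"
  by (auto simp: degL_def degR_def wt_def)

lemma raise_height:
  assumes "gl_unit i j f m \<noteq> 0" "(i = 1 \<and> j = 2) \<or> (i = 2 \<and> j = 3)"
    and "\<And>m. f m \<noteq> 0 \<Longrightarrow> h \<le> wt 1 m - wt 3 m"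
  shows "h + 1 \<le> wt 1 m - wt 3 m"
  by (rule gl_unit_support[OF assms(1)]) (use assms(2,3) in fastforce)

text \<open>No monomial of bidegree \<open>(a, b)\<close> has a height above \<open>a + b\<close>.\<close>

lemma top_vector_singular: "harm.singular (top_vector a b)"
proof -
  have "gl_unit i j (top_vector a b) = 0" if ij: "(i = 1 \<and> j = 2) \<or> (i = 2 \<and> j = 3)" for i j
  proof (rule ccontr)
    assume "gl_unit i j (top_vector a b) \<noteq> 0"
    then obtain m where m: "gl_unit i j (top_vector a b) m \<noteq> 0" by (auto simp: fun_eq_iff)
    have "int a + int b + 1 \<le> wt 1 m - wt 3 m"
      by (rule raise_height[OF m ij]) (use top_vector_mem[of a b] in \<open>auto simp: harm_sub_def\<close>)
    moreover have "gl_unit i j (top_vector a b) \<in> harmonic a b"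
      using top_vector_mem by (intro gl_unit_harmonic) (auto simp: harm_sub_def)
    ultimately show False using m height_bound(1)[of m a b] by (auto simp: harmonic_def)
  qed
  then show ?thesis by (simp add: harm.singular_def gl_act_unit)
qed

text \<open>In the full space of polynomials the singular vectors are the combinations of products of
  \<open>x\<^sub>1\<^sup>i y\<^sub>3\<^sup>j\<close> with powers of \<open>x\<^sub>1 y\<^sub>1 + x\<^sub>2 y\<^sub>2 + x\<^sub>3 y\<^sub>3\<close>, and only the power 0 is harmonic.  The proof compares
  coefficients: together with the Laplace equation, the equations for the three raising operators kill
  the coefficients at all reduced monomials other than \<open>x\<^sub>1\<^sup>a y\<^sub>3\<^sup>b\<close>.\<close>

lemma singular_unique:
  assumes f: "f \<in> harmonic a b" and sing: "harm.singular f"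
  shows "\<exists>c. f = coeff_scale c (top_vector a b)"
proof -
  have g12: "gl_unit 1 2 f = 0" and g23: "gl_unit 2 3 f = 0"
    using sing by (simp_all add: harm.singular_def gl_act_unit)
  have g13: "gl_unit 1 3 f = 0"
    using gl_unit_comm[of 1 2 2 3 f] by (simp add: g12 g23 gl_unit_linear(3))
  define F where "F x1 x2 x3 y1 y2 y3 = f (monom6 x1 x2 x3 y1 y2 y3)" for x1 x2 x3 y1 y2 y3
  have e12: "of_nat x1 * F (x1-1) (Suc x2) x3 y1 y2 y3 = of_nat y2 * F x1 x2 x3 (Suc y1) (y2-1) y3"
    for x1 x2 x3 y1 y2 y3
    using fun_cong[OF g12, of "monom6 x1 x2 x3 y1 y2 y3"] by (simp add: gl_unit_def xd_apply F_def)
  have e23: "of_nat x2 * F x1 (x2-1) (Suc x3) y1 y2 y3 = of_nat y3 * F x1 x2 x3 y1 (Suc y2) (y3-1)"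
    for x1 x2 x3 y1 y2 y3
    using fun_cong[OF g23, of "monom6 x1 x2 x3 y1 y2 y3"] by (simp add: gl_unit_def xd_apply F_def)
  have e13: "of_nat x1 * F (x1-1) x2 (Suc x3) y1 y2 y3 = of_nat y3 * F x1 x2 x3 (Suc y1) y2 (y3-1)"
    for x1 x2 x3 y1 y2 y3
    using fun_cong[OF g13, of "monom6 x1 x2 x3 y1 y2 y3"] by (simp add: gl_unit_def xd_apply F_def)
  have lap: "F (Suc x1) x2 x3 (Suc y1) y2 y3 + F x1 (Suc x2) x3 y1 (Suc y2) y3 + F x1 x2 (Suc x3) y1 y2 (Suc y3) = 0"
    for x1 x2 x3 y1 y2 y3
  proof -
    have "laplace f (monom6 x1 x2 x3 y1 y2 y3) = 0" using f by (simp add: harmonic_def)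
    then show ?thesis by (simp add: laplace_apply up_def F_def)
  qed
  have a2: "F x1 (Suc x2) x3 y1 0 y3 = 0" for x1 x2 x3 y1 y3
    using e12[of "Suc x1" x2 x3 y1 0 y3] by (simp del: of_nat_Suc)
  have a3: "F x1 x2 (Suc x3) y1 y2 0 = 0" for x1 x2 x3 y1 y2
    using e13[of "Suc x1" x2 x3 y1 y2 0] by (simp del: of_nat_Suc)
  have b1: "F 0 x2 x3 (Suc y1) y2 y3 = 0" for x2 x3 y1 y2 y3
    using e12[of 0 x2 x3 y1 "Suc y2" y3] by (simp del: of_nat_Suc)
  have b2: "F x1 0 x3 y1 (Suc y2) y3 = 0" for x1 x3 y1 y2 y3
    using e23[of 0 x1 x3 y1 y2 "Suc y3"] by (simp del: of_nat_Suc)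
  \<comment> \<open>Multiplied by \<open>x + 1\<close>, each term of the Laplace equation becomes a positive multiple of its first term.\<close>
  have c1: "F (Suc x) 0 z (Suc p) 0 r = 0" for x z p r
  proof -
    have "of_nat (Suc x) * F x 1 z p 1 r = F (Suc x) 0 z (Suc p) 0 r"
      using e12[of "Suc x" 0 z p 1 r] by simp
    moreover have "of_nat (Suc x) * F x 0 (Suc z) p 0 (Suc r) = of_nat (Suc r) * F (Suc x) 0 z (Suc p) 0 r"
      using e13[of "Suc x" 0 z p 0 "Suc r"] by simp
    moreover have "of_nat (Suc x) * (F (Suc x) 0 z (Suc p) 0 r + F x 1 z p 1 r + F x 0 (Suc z) p 0 (Suc r)) = 0"
      using lap[of x 0 z p 0 r] by simp
    ultimately have "(of_nat (Suc x) + 1 + of_nat (Suc r)) * F (Suc x) 0 z (Suc p) 0 r = 0"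
      by (simp add: algebra_simps)
    moreover have "of_nat (Suc x) + 1 + of_nat (Suc r) = (of_nat (Suc x + 1 + Suc r) :: complex)" by simp
    ultimately show ?thesis by (metis add_is_0 mult_eq_0_iff nat.simps(3) of_nat_eq_0_iff)
  qed
  have c2: "F x 0 z (Suc p) 0 r = 0" for x z p r using c1 b1 by (cases x) auto
  have c3: "F x 0 (Suc z) 0 0 r = 0" for x z r
  proof (cases r)
    case (Suc s)
    have "of_nat (Suc x) * F x 0 (Suc z) 0 0 r = 0"
      using e13[of "Suc x" 0 z 0 0 r] c2[of "Suc x" z 0 s] Suc by simp
    then show ?thesis by (simp del: of_nat_Suc)
  qed (simp add: a3)
  let ?g = "f - coeff_scale (f (monom6 a 0 0 0 0 b)) (top_vector a b)"
  have top: "top_vector a b \<in> harmonic a b" using top_vector_mem by (auto simp: harm_sub_def)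
  have "laplace (?g + coeff_scale (f (monom6 a 0 0 0 0 b)) (top_vector a b)) = 0"
    using f by (simp add: harmonic_def)
  then have "laplace ?g = 0" using top
    unfolding laplace_linear by (simp add: harmonic_def)
  moreover have "?g m = 0" if m: "reduced m" for m
  proof (cases "m = monom6 a 0 0 0 0 b")
    case True
    then show ?thesis by (simp add: top_vector_def coeff_scale_def harm_basis_reduced top_reduced)
  next
    case False
    have "f m = 0"
    proof (rule ccontr)
      assume nz: "f m \<noteq> 0"
      obtain x1 x2 x3 y1 y2 y3 where mm: "m = monom6 x1 x2 x3 y1 y2 y3" using monom6_collapse by metis
      have F: "F x1 x2 x3 y1 y2 y3 \<noteq> 0" using nz by (simp add: F_def mm)
      have xy: "x2 = 0 \<or> y2 = 0" using m by (simp add: mm reduced_def)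
      then have 2: "x2 = 0" "y2 = 0" using F a2 b2 by (metis not0_implies_Suc)+
      then have "y1 = 0" using F c2 by (metis not0_implies_Suc)
      then have "x3 = 0" using F c3 2 by (metis not0_implies_Suc)
      have "degL m = a" "degR m = b" using f nz by (auto simp: harmonic_def)
      then show False using False mm 2 \<open>y1 = 0\<close> \<open>x3 = 0\<close> by simp
    qed
    then show ?thesis
      using False by (simp add: top_vector_def coeff_scale_def harm_basis_reduced m)
  qed
  ultimately have "?g = 0" by (rule harmonic_zero)
  then show ?thesis by (metis eq_iff_diff_eq_0)
qed

text \<open>Raising operators increase the height, which is bounded.  So an element whose lowest height is as large
  as possible among the nonzero elements of the submodule must be killed by them.\<close>

lemma submodule_singular:
  assumes U: "harm.submodule a b U" "U \<noteq> {0}"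
  shows "\<exists>f\<in>U. f \<noteq> 0 \<and> harm.singular f"
proof -
  have UV: "U \<subseteq> harmonic a b" and U0: "0 \<in> U"
    using U by (auto simp: harm.submodule_def co.subspace_0)
  define P where "P k \<longleftrightarrow> (\<exists>f\<in>U. f \<noteq> 0 \<and> (\<forall>m. f m \<noteq> 0 \<longrightarrow> int k \<le> wt 1 m - wt 3 m + (int a + int b)))" for k :: nat
  have bound: "k \<le> 2 * (a + b)" if "P k" for k
  proof -
    obtain f m where "f \<in> U" "f m \<noteq> 0" "int k \<le> wt 1 m - wt 3 m + (int a + int b)"
      using \<open>P k\<close> unfolding P_def by (auto simp: fun_eq_iff)
    then show ?thesis using UV height_bound(1)[of m a b] by (auto simp: harmonic_def)
  qed
  have "P 0"
  proof -
    obtain f where "f \<in> U" "f \<noteq> 0" using U U0 by auto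
    then show ?thesis unfolding P_def using UV height_bound(2)[of _ a b]
      by (intro bexI[of _ f]) (fastforce simp: harmonic_def)+
  qed
  then obtain k where k: "P k" "\<And>j. P j \<Longrightarrow> j \<le> k"
    using bound by (metis GreatestI_nat Greatest_le_nat)
  then obtain f where f: "f \<in> U" "f \<noteq> 0" "\<And>m. f m \<noteq> 0 \<Longrightarrow> int k - (int a + int b) \<le> wt 1 m - wt 3 m"
    unfolding P_def by (force simp: algebra_simps)
  have "gl_unit i j f = 0" if ij: "(i = 1 \<and> j = 2) \<or> (i = 2 \<and> j = 3)" for i j
  proof (rule ccontr)
    assume nz: "gl_unit i j f \<noteq> 0"
    have "mat_unit i j \<in> sl3" using ij by (intro mat_unit_sl3) auto
    then have "gl_unit i j f \<in> U"
      using U f(1) unfolding harm.submodule_def by (metis gl_act_unit)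
    moreover have "int (Suc k) \<le> wt 1 m - wt 3 m + (int a + int b)" if "gl_unit i j f m \<noteq> 0" for m
      using raise_height[OF that ij f(3)] by simp
    ultimately have "P (Suc k)" unfolding P_def using nz by blast
    then show False using k(2) by fastforce
  qed
  then show ?thesis using f by (auto simp: harm.singular_def gl_act_unit)
qed

section \<open>Irreducibility via a contravariant Hermitian form\<close>

definition monom_fact :: "('k::finite \<Rightarrow> nat) \<Rightarrow> nat" where
  "monom_fact m = (\<Prod>k\<in>UNIV. fact (m k))"

lemma monom_fact_Suc: "monom_fact (m(k := Suc (m k))) = Suc (m k) * monom_fact m"
proof -
  have "(\<Prod>x\<in>UNIV - {k}. fact ((m(k := Suc (m k))) x)) = (\<Prod>x\<in>UNIV - {k}. fact (m x) :: nat)"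
    by (rule prod.cong) auto
  then show ?thesis by (simp add: monom_fact_def prod.remove[of UNIV k] algebra_simps)
qed

lemma monom_fact_pos: "monom_fact m > 0"
  by (simp add: monom_fact_def prod_pos)

definition degrees :: "nat \<Rightarrow> nat \<Rightarrow> monom set" where
  "degrees a b = {m. degL m = a \<and> degR m = b}"

text \<open>The Fock inner product, for which \<open>\<partial>/\<partial>x\<^sub>k\<close> is adjoint to multiplication by \<open>x\<^sub>k\<close>: the monomial \<open>x\<^sup>m\<close>
  has squared norm \<open>m!\<close>, hence the divided power \<open>x\<^sup>m / m!\<close> has squared norm \<open>1 / m!\<close>.\<close>

definition form :: "nat \<Rightarrow> nat \<Rightarrow> (3 + 3) coeffs \<Rightarrow> (3 + 3) coeffs \<Rightarrow> complex" where
  "form a b f g = (\<Sum>m\<in>degrees a b. f m * cnj (g m) / of_nat (monom_fact m))"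

lemma finite_deg: "finite (degrees a b)" unfolding degrees_def by (rule finite_degrees)

lemma form_linear:
  "form a b (f + f') g = form a b f g + form a b f' g"
  "form a b (f - f') g = form a b f g - form a b f' g"
  "form a b f (g + g') = form a b f g + form a b f g'"
  "form a b f (g - g') = form a b f g - form a b f g'"
  "form a b (coeff_scale c f) g = c * form a b f g"
  "form a b f (coeff_scale c g) = cnj c * form a b f g"
  "form a b 0 g = 0" "form a b f 0 = 0"
  by (simp_all add: form_def coeff_scale_def algebra_simps sum.distrib sum_subtractf sum_distrib_left
      add_divide_distrib diff_divide_distrib)

lemma form_sum: "form a b (\<Sum>x\<in>S. h x) g = (\<Sum>x\<in>S. form a b (h x) g)"
  "form a b g (\<Sum>x\<in>S. h x) = (\<Sum>x\<in>S. form a b g (h x))"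
  by (induction S rule: infinite_finite_induct,
    simp_all only: sum.empty sum.insert sum.infinite form_linear not_False_eq_True)

lemma form_definite:
  assumes "f \<in> harmonic a b" "form a b f f = 0"
  shows "f = 0"
proof
  fix m
  have "form a b f f = of_real (\<Sum>m\<in>degrees a b. (cmod (f m))\<^sup>2 / real (monom_fact m))"
    by (simp add: form_def complex_norm_square[symmetric])
  then have "(\<Sum>m\<in>degrees a b. (cmod (f m))\<^sup>2 / real (monom_fact m)) = 0"
    using assms(2) by (metis of_real_eq_0_iff)
  then have "\<forall>m\<in>degrees a b. (cmod (f m))\<^sup>2 / real (monom_fact m) = 0"
    by (subst (asm) sum_nonneg_eq_0_iff) (auto simp: finite_deg)
  then show "f m = 0 m"
    using assms(1) monom_fact_pos[of m] by (auto simp: harmonic_def degrees_def)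
qed

text \<open>The hypotheses on degrees say that moving a unit of exponent between \<open>k\<close> and \<open>l\<close> preserves the bidegree, so
  that the sum can be reindexed along this move; the factorials absorb the change of factors.\<close>

lemma form_xd:
  assumes kl: "k \<noteq> l" and S: "\<And>m. m k \<noteq> 0 \<Longrightarrow>
     m(k := m k - 1, l := Suc (m l)) \<in> degrees a b \<longleftrightarrow> m \<in> degrees a b"
  and S': "\<And>m. m l \<noteq> 0 \<Longrightarrow>
     m(l := m l - 1, k := Suc (m k)) \<in> degrees a b \<longleftrightarrow> m \<in> degrees a b"
  shows "form a b (xd k l f) g = form a b f (xd l k g)"
proof -
  have "form a b (xd k l f) g = (\<Sum>m | m \<in> degrees a b \<and> m k \<noteq> 0. xd k l f m * cnj (g m) / of_nat (monom_fact m))"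
    unfolding form_def by (rule sum.mono_neutral_right) (auto simp: finite_deg xd_apply)
  also have "\<dots> = (\<Sum>m | m \<in> degrees a b \<and> m l \<noteq> 0. f m * cnj (xd l k g m) / of_nat (monom_fact m))"
  proof (rule sum.reindex_bij_witness[where j = "\<lambda>m. m(k := m k - 1, l := Suc (m l))"
        and i = "\<lambda>m. m(l := m l - 1, k := Suc (m k))"])
    fix m assume m: "m \<in> {m. m \<in> degrees a b \<and> m k \<noteq> 0}"
    let ?m = "m(k := m k - 1, l := Suc (m l))"
    show "?m(l := ?m l - 1, k := Suc (?m k)) = m"
      using kl m by (auto simp: fun_eq_iff)
    show "?m \<in> {m. m \<in> degrees a b \<and> m l \<noteq> 0}" using S m by auto
    let ?n = "m(k := m k - 1)"
    have "?n(k := Suc (?n k)) = m" "Suc (?n k) = m k" "?n l = m l" using kl m by auto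
    then have "monom_fact m = m k * monom_fact ?n" "monom_fact ?m = Suc (m l) * monom_fact ?n"
      using monom_fact_Suc[of ?n k] monom_fact_Suc[of ?n l] by simp_all
    moreover have "m(k := m k - 1, l := Suc (m l), l := m l, k := m k) = m" by auto
    ultimately show "f ?m * cnj (xd l k g ?m) / of_nat (monom_fact ?m)
       = xd k l f m * cnj (g m) / of_nat (monom_fact m)"
      using kl m monom_fact_pos[of ?n] by (auto simp: xd_apply simp del: of_nat_Suc mult_Suc)
  next
    fix m assume m: "m \<in> {m. m \<in> degrees a b \<and> m l \<noteq> 0}"
    let ?m = "m(l := m l - 1, k := Suc (m k))"
    show "?m(k := ?m k - 1, l := Suc (?m l)) = m"
      using kl m by (auto simp: fun_eq_iff)
    show "?m \<in> {m. m \<in> degrees a b \<and> m k \<noteq> 0}" using S' m by auto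
  qed
  also have "\<dots> = form a b f (xd l k g)"
    unfolding form_def by (rule sum.mono_neutral_left) (auto simp: finite_deg xd_apply)
  finally show ?thesis .
qed

lemma form_gl_unit: "form a b (gl_unit i j f) g = form a b f (gl_unit j i g)"
proof -
  have "form a b (xd (Inl i) (Inl j) f) g = form a b f (xd (Inl j) (Inl i) g)" for i j f g
  proof (cases "i = j")
    case True
    then show ?thesis by (auto simp: form_def xd_diag intro!: sum.cong)
  next
    case False
    then show ?thesis
      using exhaust_3[of i] exhaust_3[of j]
      by (intro form_xd) (auto simp: degrees_def degL_def degR_def)
  qed
  moreover have "form a b (xd (Inr i) (Inr j) f) g = form a b f (xd (Inr j) (Inr i) g)" for i j f g
  proof (cases "i = j")
    case True
    then show ?thesis by (auto simp: form_def xd_diag intro!: sum.cong)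
  next
    case False
    then show ?thesis
      using exhaust_3[of i] exhaust_3[of j]
      by (intro form_xd) (auto simp: degrees_def degL_def degR_def)
  qed
  ultimately show ?thesis by (simp add: gl_unit_def form_linear)
qed

definition adjoint_mat :: "complex^3^3 \<Rightarrow> complex^3^3" where
  "adjoint_mat A = (\<chi> i j. cnj (A$j$i))"

lemma adjoint_sl3: "A \<in> sl3 \<Longrightarrow> adjoint_mat A \<in> sl3"
  by (simp add: sl3_def trace_def adjoint_mat_def flip: cnj_sum)

lemma form_gl_act: "form a b (gl_act A f) g = form a b f (gl_act (adjoint_mat A) g)"
proof -
  have "form a b (gl_act A f) g = (\<Sum>i\<in>UNIV. \<Sum>j\<in>UNIV. A$i$j * form a b f (gl_unit j i g))"
    by (simp add: gl_act_def form_sum form_linear form_gl_unit)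
  also have "\<dots> = form a b f (gl_act (adjoint_mat A) g)"
    by (subst sum.swap) (simp add: gl_act_def form_sum form_linear adjoint_mat_def)
  finally show ?thesis .
qed

text \<open>The Gram-Schmidt process.\<close>

lemma orthogonal_projection:
  assumes "finite B" "B \<subseteq> harmonic a b"
  shows "\<exists>u\<in>co.span B. \<forall>x\<in>co.span B. form a b (w - u) x = 0"
  using assms
proof (induction B arbitrary: w rule: finite_induct)
  case empty
  then show ?case by (auto simp: form_def)
next
  case (insert v B)
  then have IH: "\<And>w. \<exists>u\<in>co.span B. \<forall>x\<in>co.span B. form a b (w - u) x = 0"
    using insert.IH insert.prems by blast
  obtain vb where vb: "vb \<in> co.span B" "\<And>x. x \<in> co.span B \<Longrightarrow> form a b (v - vb) x = 0" using IH by blast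
  obtain wb where wb: "wb \<in> co.span B" "\<And>x. x \<in> co.span B \<Longrightarrow> form a b (w - wb) x = 0" using IH by blast
  have sub: "co.span B \<subseteq> co.span (insert v B)" by (rule co.span_mono) auto
  have "co.span B \<subseteq> harmonic a b"
    using insert.prems by (intro co.span_minimal subspace_harmonic) auto
  then have vv: "v - vb \<in> harmonic a b"
    using insert.prems vb by (intro co.subspace_diff[OF subspace_harmonic]) auto
  let ?v = "v - vb" and ?w = "w - wb"
  define c where "c = form a b ?w ?v / form a b ?v ?v"
  let ?u = "wb + coeff_scale c ?v"
  have vm: "?v \<in> co.span (insert v B)"
    by (intro co.span_diff[OF co.span_base subsetD[OF sub vb(1)]]) simp
  then have "?u \<in> co.span (insert v B)"
    by (intro co.span_add[OF subsetD[OF sub wb(1)]] co.span_scale)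
  moreover have "form a b (w - ?u) x = 0" if x: "x \<in> co.span (insert v B)" for x
  proof -
    obtain k where k: "x - coeff_scale k v \<in> co.span B"
      using x by (auto simp: co.span_breakdown_eq)
    let ?y = "x - coeff_scale k v + coeff_scale k vb"
    have y: "?y \<in> co.span B" by (intro co.span_add[OF k] co.span_scale vb(1))
    have xe: "x = ?y + coeff_scale k ?v" by (simp add: co.scale_right_diff_distrib)
    have e: "form a b (w - ?u) z = form a b ?w z - c * form a b ?v z" for z
      by (simp add: form_linear)
    have "form a b ?w ?v - c * form a b ?v ?v = 0"
    proof (cases "form a b ?v ?v = 0")
      case True
      then have "?v = 0" using form_definite vv by blast
      then show ?thesis by (simp only: form_linear) simp
    qed (simp add: c_def)
    then have "form a b (w - ?u) ?v = 0" by (simp only: e)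
    moreover have "form a b (w - ?u) ?y = 0"
      by (simp only: e wb(2)[OF y] vb(2)[OF y]) simp
    ultimately show ?thesis by (subst xe) (simp only: form_linear, simp)
  qed
  ultimately show ?case by blast
qed

lemma harmonic_eq_sub: "harmonic a b = harm_sub a b (\<lambda>_ _. True)"
  by (simp add: harm_sub_def)

text \<open>A proper nonzero submodule and its orthogonal complement would both contain \<open>top_vector a b\<close>,
  which is not orthogonal to itself.\<close>

theorem harmonic_irreducible: "harm.irreducible a b"
  unfolding harm.irreducible_def
proof (intro conjI allI impI)
  have top: "top_vector a b \<in> harmonic a b" using top_vector_mem by (auto simp: harm_sub_def)
  show "harmonic a b \<noteq> {0}" using top top_vector_nz by auto
  have has_top: "top_vector a b \<in> U" if U: "harm.submodule a b U" "U \<noteq> {0}" for U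
  proof -
    obtain f where f: "f \<in> U" "f \<noteq> 0" "harm.singular f" using submodule_singular[OF U] by blast
    moreover have "f \<in> harmonic a b" using f U by (auto simp: harm.submodule_def)
    ultimately obtain c where c: "f = coeff_scale c (top_vector a b)" using singular_unique by blast
    then have "c \<noteq> 0" using f by auto
    have "coeff_scale (1/c) f \<in> U" using U f by (auto simp: harm.submodule_def co.subspace_scale)
    then show ?thesis using c \<open>c \<noteq> 0\<close> by simp
  qed
  fix U assume U: "harm.submodule a b U"
  show "U = {0} \<or> U = harmonic a b"
  proof (rule ccontr)
    assume neg: "\<not> (U = {0} \<or> U = harmonic a b)"
    have sU: "co.subspace U" and UV: "U \<subseteq> harmonic a b" using U by (auto simp: harm.submodule_def)
    then obtain w where w: "w \<in> harmonic a b" "w \<notin> U" using neg by auto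
    obtain B where B: "B \<subseteq> U" "co.independent B" "U \<subseteq> co.span B" using co.maximal_independent_subset by metis
    have "harmonic a b \<subseteq> co.span (harm_basis ` index_set a b (\<lambda>_ _. True))"
      unfolding harmonic_eq_sub by (rule harm_sub_span)
    then have "B \<subseteq> co.span (harm_basis ` index_set a b (\<lambda>_ _. True))" using B(1) UV by (meson subset_trans)
    then have "finite B"
      using co.independent_span_bound[OF finite_imageI[OF finite_index_set] B(2)] by metis
    moreover have "B \<subseteq> harmonic a b" using B UV by auto
    ultimately have "\<exists>u\<in>co.span B. \<forall>x\<in>co.span B. form a b (w - u) x = 0"
      by (rule orthogonal_projection)
    then obtain u where u: "u \<in> co.span B" "\<forall>x\<in>co.span B. form a b (w - u) x = 0" ..
    have sB: "co.span B = U" by (rule subset_antisym[OF co.span_minimal[OF B(1) sU] B(3)])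
    let ?W = "{g \<in> harmonic a b. \<forall>x\<in>U. form a b g x = 0}"
    have "harm.submodule a b ?W"
      unfolding harm.submodule_def
    proof (intro conjI ballI)
      show "co.subspace ?W"
        unfolding co.subspace_def using harm.V_0 harm.V_add harm.V_scale
        by (auto simp: form_linear)
      show "gl_act A g \<in> ?W" if "A \<in> sl3" "g \<in> ?W" for A g
        using that U adjoint_sl3[OF that(1)]
        by (auto simp: gl_act_harmonic form_gl_act harm.submodule_def)
    qed auto
    moreover have "w - u \<in> ?W"
      using u w UV unfolding sB by (auto intro: co.subspace_diff[OF subspace_harmonic])
    moreover have "w - u \<noteq> 0" using u(1) w unfolding sB by auto
    ultimately have "top_vector a b \<in> ?W" using has_top[of ?W] by blast
    moreover have "top_vector a b \<in> U" using has_top U neg by blast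
    ultimately show False using form_definite[OF top] top_vector_nz by auto
  qed
qed

section \<open>Multiplicities in the irreducible modules\<close>

text \<open>The model lives on functions of exponents, whereas \<open>irr_module\<close> is chosen among spaces of sequences.
  An enumeration of the monomials moves the model there.\<close>

lemma ex_monom_enum: "\<exists>c :: nat \<Rightarrow> monom. bij c"
proof -
  have "infinite (UNIV :: monom set)"
  proof
    assume "finite (UNIV :: monom set)"
    then have "finite (range (\<lambda>n::nat. (\<lambda>k. n) :: monom))" by (rule finite_subset[rotated]) simp
    moreover have "inj (\<lambda>n::nat. (\<lambda>k. n) :: monom)" by (auto simp: inj_def fun_eq_iff)
    ultimately show False using finite_imageD by blast
  qed
  then have "bij_betw (from_nat_into (UNIV :: monom set)) UNIV UNIV"
    by (intro bij_betw_from_nat_into) auto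
  then show ?thesis by blast
qed

definition monom_enum :: "nat \<Rightarrow> monom" where "monom_enum = (SOME c. bij c)"

lemma bij_monom_enum: "bij monom_enum"
  unfolding monom_enum_def by (rule someI_ex[OF ex_monom_enum])

definition to_seq :: "(3 + 3) coeffs \<Rightarrow> cseq" where "to_seq f = f \<circ> monom_enum"
definition of_seq :: "cseq \<Rightarrow> (3 + 3) coeffs" where "of_seq g = g \<circ> inv_into UNIV monom_enum"

lemma of_seq_to_seq: "of_seq (to_seq f) = f"
  using bij_monom_enum by (simp add: of_seq_def to_seq_def fun_eq_iff bij_is_surj surj_f_inv_f)

lemma to_seq_of_seq: "to_seq (of_seq f) = f"
  using bij_monom_enum by (simp add: of_seq_def to_seq_def fun_eq_iff bij_is_inj)

lemma to_seq_linear: "to_seq (f + g) = to_seq f + to_seq g"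
  "to_seq (f - g) = to_seq f - to_seq g"
  "to_seq (coeff_scale c f) = seq_scale c (to_seq f)" "to_seq 0 = 0"
  by (simp_all add: to_seq_def coeff_scale_def seq_scale_def fun_eq_iff)

lemma to_seq_eq_0: "to_seq f = 0 \<longleftrightarrow> f = 0"
  using of_seq_to_seq[of f] of_seq_to_seq[of 0] to_seq_linear(4) by metis

lemma linear_to_seq: "Vector_Spaces.linear coeff_scale seq_scale to_seq"
  by unfold_locales (simp_all only: to_seq_linear)

definition seq_module :: "nat \<Rightarrow> nat \<Rightarrow> sl3_rep" where
  "seq_module a b = (to_seq ` harmonic a b, \<lambda>A g. to_seq (gl_act A (of_seq g)))"

lemma seq_module_irreducible: "irreducible_module (seq_module a b)"
proof -
  interpret L: Vector_Spaces.linear coeff_scale seq_scale to_seq by (rule linear_to_seq)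
  have sub: "cs.subspace (to_seq ` harmonic a b)"
    by (rule L.subspace_image[OF subspace_harmonic])
  have "co.span (harm_basis ` index_set a b (\<lambda>_ _. True)) = harmonic a b"
    using harm_basis_mem[of _ a b "\<lambda>_ _. True"] harm_sub_span[of a b "\<lambda>_ _. True"]
    by (intro subset_antisym co.span_minimal subspace_harmonic) (auto simp: harmonic_eq_sub[symmetric])
  then have "to_seq ` harmonic a b = cs.span (to_seq ` harm_basis ` index_set a b (\<lambda>_ _. True))"
    by (simp only: L.span_image)
  then have fin: "\<exists>B. finite B \<and> to_seq ` harmonic a b = cs.span B"
    by (intro exI conjI) (auto simp: finite_index_set)
  have mod: "sl3_module (seq_module a b)"
    unfolding sl3_module_def seq_module_def prod.case
    using sub fin
    by (intro conjI ballI allI;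
      auto simp only: of_seq_to_seq gl_act_harmonic gl_act_add gl_act_scale gl_act_mat_add gl_act_mat_scale
        gl_act_bracket to_seq_linear[symmetric] image_iff)
  have "to_seq (top_vector a b) \<in> to_seq ` harmonic a b"
    using top_vector_mem[of a b] by (auto simp: harm_sub_def)
  moreover have "to_seq (top_vector a b) \<noteq> 0" by (metis to_seq_eq_0 top_vector_nz)
  ultimately have nz: "to_seq ` harmonic a b \<noteq> {0}" by blast
  have irr: "U = {0} \<or> U = to_seq ` harmonic a b"
    if U: "cs.subspace U" "U \<subseteq> to_seq ` harmonic a b" "\<And>A u. A \<in> sl3 \<Longrightarrow> u \<in> U \<Longrightarrow> to_seq (gl_act A (of_seq u)) \<in> U" for U
  proof -
    let ?U = "{f. to_seq f \<in> U}"
    have im: "to_seq ` ?U = U" using to_seq_of_seq by (auto simp: image_iff) metis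
    have "harm.submodule a b ?U"
      unfolding harm.submodule_def
    proof (intro conjI ballI)
      show "co.subspace ?U" by (rule L.subspace_vimage[OF U(1), unfolded vimage_def])
      show "?U \<subseteq> harmonic a b"
      proof
        fix f assume "f \<in> ?U"
        then obtain g where "to_seq f = to_seq g" "g \<in> harmonic a b" using U(2) by auto
        then show "f \<in> harmonic a b" by (metis of_seq_to_seq)
      qed
      show "gl_act A f \<in> ?U" if "A \<in> sl3" "f \<in> ?U" for A f
        using U(3)[of A "to_seq f"] that by (simp add: of_seq_to_seq)
    qed
    then have "?U = {0} \<or> ?U = harmonic a b" using harmonic_irreducible unfolding harm.irreducible_def by blast
    then show ?thesis using im to_seq_linear(4) by (metis image_empty image_insert)
  qed
  show ?thesis
    unfolding irreducible_module_def seq_module_def prod.case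
    using mod[unfolded seq_module_def] nz irr by blast
qed

lemma seq_module_highest_weight:
  assumes "lam $ 1 - lam $ 2 = real a" "lam $ 2 - lam $ 3 = real b"
  shows "has_highest_weight (seq_module a b) lam"
proof -
  have w: "top_vector a b \<in> harm.wspace a b lam"
    using wspace_harmonic[of lam "int a" "int b" a b] assms top_vector_mem[of a b] by simp
  have "to_seq (top_vector a b) \<in> weight_space (seq_module a b) lam"
    using w by (auto simp: weight_space_def seq_module_def harm.wspace_def of_seq_to_seq to_seq_linear)
  moreover have "to_seq (top_vector a b) \<noteq> 0" using top_vector_nz by (simp only: to_seq_eq_0) simp
  moreover have "snd (seq_module a b) (mat_unit 1 2) (to_seq (top_vector a b)) = 0"
    "snd (seq_module a b) (mat_unit 2 3) (to_seq (top_vector a b)) = 0"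
    using top_vector_singular[of a b]
    by (simp_all add: seq_module_def of_seq_to_seq harm.singular_def to_seq_linear)
  ultimately show ?thesis unfolding has_highest_weight_def by blast
qed

text \<open>The model shows that the choice in \<open>irr_module\<close> is not vacuous, and uniqueness then identifies whatever
  module was chosen with the model.\<close>

theorem irr_module_dimensions:
  assumes lam: "lam $ 1 - lam $ 2 = real a" "lam $ 2 - lam $ 3 = real b"
  shows "irr_dim lam = card (index_set a b (\<lambda>_ _. True))"
    and "\<mu> $ 1 - \<mu> $ 2 = of_int p \<Longrightarrow> \<mu> $ 2 - \<mu> $ 3 = of_int q \<Longrightarrow>
      weight_mult lam \<mu> = card (index_set a b (\<lambda>x y. x = p \<and> y = q))"
proof -
  obtain V act where M: "irr_module lam = (V, act)" by fastforce
  have "\<exists>M. irreducible_module M \<and> has_highest_weight M lam"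
    using seq_module_irreducible seq_module_highest_weight[OF lam] by blast
  then have "irreducible_module (irr_module lam) \<and> has_highest_weight (irr_module lam) lam"
    unfolding irr_module_def by (rule someI_ex)
  then have irr: "irreducible_module (V, act)" and hw: "has_highest_weight (V, act) lam"
    by (simp_all add: M)
  then have mod: "sl3_module (V, act)" by (simp add: irreducible_module_def)
  interpret A: sl3_rep_on seq_scale V act
    using mod unfolding sl3_module_def prod.case by unfold_locales blast+
  interpret two_reps seq_scale V act coeff_scale "harmonic a b" gl_act
    by unfold_locales
  have ws: "A.wspace \<nu> = weight_space (V, act) \<nu>" for \<nu>
    by (simp add: A.wspace_def weight_space_def)
  obtain v where v: "v \<in> A.wspace lam" "v \<noteq> 0" "A.singular v"
    using hw unfolding ws has_highest_weight_def A.singular_def by auto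
  have Airr: "A.irreducible"
    using irr unfolding A.irreducible_def A.submodule_def irreducible_module_def prod.case by blast
  have "top_vector a b \<in> harm.wspace a b lam"
    using wspace_harmonic[of lam "int a" "int b" a b] assms top_vector_mem[of a b] by simp
  note uniq = highest_weight_unique[OF Airr harmonic_irreducible v(1,3,2) this top_vector_singular top_vector_nz]
  show "irr_dim lam = card (index_set a b (\<lambda>_ _. True))"
    using uniq(1) harm_sub_dim[of a b "\<lambda>_ _. True"] by (simp add: irr_dim_def M harmonic_eq_sub)
  show "weight_mult lam \<mu> = card (index_set a b (\<lambda>x y. x = p \<and> y = q))"
    if "\<mu> $ 1 - \<mu> $ 2 = of_int p" "\<mu> $ 2 - \<mu> $ 3 = of_int q"
    using uniq(2)[of \<mu>] harm_sub_dim[of a b] wspace_harmonic[OF that, of a b]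
    by (simp add: weight_mult_def M ws)
qed

section \<open>Counting reduced monomials modulo 3\<close>

text \<open>The complete homogeneous symmetric polynomial of degree \<open>n\<close> evaluated at \<open>(x, 1, y)\<close>, i.e. the
  character of the space of polynomials of degree \<open>n\<close> in three variables.\<close>

definition triangle_sum :: "'a::comm_ring_1 \<Rightarrow> 'a \<Rightarrow> nat \<Rightarrow> 'a" where
  "triangle_sum x y n = (\<Sum>i\<le>n. \<Sum>k\<le>n - i. x ^ i * y ^ k)"

lemma triangle_sum_0: "triangle_sum x y 0 = 1" by (simp add: triangle_sum_def)

lemma triangle_sum_Suc: "triangle_sum x y (Suc n) = x * triangle_sum x y n + (\<Sum>k\<le>Suc n. y ^ k)"
  unfolding triangle_sum_def
  by (subst sum.atMost_Suc_shift) (simp add: sum_distrib_left mult.assoc)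

lemma triangle_sum_one: "triangle_sum 1 1 n = (of_nat (n + 1) * of_nat (n + 2) / 2 :: complex)"
  by (induction n) (simp_all add: triangle_sum_0 triangle_sum_Suc field_simps)

lemma cube_root_powers:
  fixes x :: "'a::comm_ring_1"
  assumes "1 + x + x^2 = 0"
  shows "x ^ 3 = 1"
proof -
  have "x ^ 3 - 1 = (x - 1) * (1 + x + x^2)" by (simp add: algebra_simps power2_eq_square power3_eq_cube)
  then show ?thesis using assms by simp
qed

lemma geometric_cube_root:
  fixes y :: "'a::comm_ring_1"
  assumes y: "1 + y + y^2 = 0"
  shows "(\<Sum>k\<le>3 * q. y ^ k) = 1 \<and> (\<Sum>k\<le>3 * q + 1. y ^ k) = 1 + y \<and> (\<Sum>k\<le>3 * q + 2. y ^ k) = 0"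
proof (induction q)
  case 0
  then show ?case using y by (simp add: numeral_2_eq_2)
next
  case (Suc q)
  have "(\<Sum>k\<le>n + 3. y ^ k) = (\<Sum>k\<le>n. y ^ k) + y ^ Suc n * (1 + y + y^2)" for n
    by (simp add: numeral_eq_Suc algebra_simps)
  then have periodic: "(\<Sum>k\<le>n + 3. y ^ k) = (\<Sum>k\<le>n. y ^ k)" for n using y by simp
  have "3 * Suc q = 3 * q + 3" "3 * q + 3 + 1 = 3 * q + 1 + 3" "3 * q + 3 + 2 = 3 * q + 2 + 3" by simp_all
  then show ?case using Suc by (simp only: periodic)
qed

text \<open>The generating function \<open>1 / ((1 - t)(1 - xt)(1 - x\<^sup>2 t))\<close> of these values is \<open>1 / (1 - t\<^sup>3)\<close>.\<close>

lemma triangle_sum_cube_root: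
  fixes x :: "'a::comm_ring_1"
  assumes x: "1 + x + x^2 = 0"
  shows "triangle_sum x (x^2) n = (if 3 dvd n then 1 else 0)"
proof -
  have x3: "x ^ 3 = 1" by (rule cube_root_powers[OF x])
  have y: "1 + x^2 + (x^2)^2 = 0"
  proof -
    have "(x^2)^2 = x * x ^ 3" by (simp add: numeral_eq_Suc)
    then show ?thesis using x x3 by (simp add: add_ac)
  qed
  have nx: "1 + x^2 = - x" using x by (simp add: eq_neg_iff_add_eq_0 add_ac)
  note g = geometric_cube_root[OF y]
  have "triangle_sum x (x^2) (3 * q) = 1 \<and> triangle_sum x (x^2) (3 * q + 1) = 0
      \<and> triangle_sum x (x^2) (3 * q + 2) = 0" for q
  proof -
    have step: "triangle_sum x (x^2) (3 * q + 1) = 0 \<and> triangle_sum x (x^2) (3 * q + 2) = 0"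
      if "triangle_sum x (x^2) (3 * q) = 1" for q
    proof -
      have "triangle_sum x (x^2) (3 * q + 1) = x * triangle_sum x (x^2) (3 * q) + (\<Sum>k\<le>3 * q + 1. (x^2) ^ k)"
        using triangle_sum_Suc[of x "x^2" "3 * q"] by (simp only: Suc_eq_plus1)
      also have "(\<Sum>k\<le>3 * q + 1. (x^2) ^ k) = - x" using g nx by metis
      finally have 1: "triangle_sum x (x^2) (3 * q + 1) = 0" by (simp only: that) simp
      have "triangle_sum x (x^2) (3 * q + 2) = x * triangle_sum x (x^2) (3 * q + 1) + (\<Sum>k\<le>3 * q + 2. (x^2) ^ k)"
        using triangle_sum_Suc[of x "x^2" "3 * q + 1"] by (simp only: Suc_eq_plus1 add.assoc one_add_one)
      also have "(\<Sum>k\<le>3 * q + 2. (x^2) ^ k) = 0" using g by blast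
      finally show ?thesis using 1 by (simp only: mult_zero_right add_0_right)
    qed
    have "triangle_sum x (x^2) (3 * q) = 1"
    proof (induction q)
      case (Suc q)
      have "3 * Suc q = Suc (3 * q + 2)" by simp
      then show ?case
        using triangle_sum_Suc[of x "x^2" "3 * q + 2"] g[of "Suc q"] step[OF Suc]
        by (metis add_0 mult_zero_right)
    qed (simp add: triangle_sum_0)
    then show ?thesis using step by blast
  qed
  note h = this[of "n div 3"]
  have "n = 3 * (n div 3) + n mod 3" by simp
  moreover have "n mod 3 = 0 \<or> n mod 3 = 1 \<or> n mod 3 = 2" by auto
  ultimately consider "n = 3 * (n div 3)" "3 dvd n" | "n = 3 * (n div 3) + 1" "\<not> 3 dvd n"
    | "n = 3 * (n div 3) + 2" "\<not> 3 dvd n" by (metis add.right_neutral dvd_eq_mod_eq_0 one_neq_zero zero_neq_numeral)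
  then show ?thesis using h by cases (metis)+
qed

abbreviation "reduced_set a b \<equiv> index_set a b (\<lambda>_ _. True)"

lemma sum_degrees:
  fixes x y z w :: complex
  shows "(\<Sum>m\<in>degrees a b. x ^ m (Inl 1) * y ^ m (Inl 3) * z ^ m (Inr 1) * w ^ m (Inr 3))
    = triangle_sum x y a * triangle_sum z w b"
proof -
  let ?T = "\<lambda>n. Sigma {..n} (\<lambda>i. {..n - i :: nat})"
  have t: "triangle_sum x y n = (\<Sum>p\<in>?T n. x ^ fst p * y ^ snd p)" for x y :: complex and n
    unfolding triangle_sum_def by (subst sum.Sigma) (auto simp: split_def)
  have "triangle_sum x y a * triangle_sum z w b = (\<Sum>r\<in>?T a \<times> ?T b.
      x ^ fst (fst r) * y ^ snd (fst r) * (z ^ fst (snd r) * w ^ snd (snd r)))"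
    unfolding t sum_product by (subst sum.cartesian_product) (simp add: split_def)
  also have "\<dots> = (\<Sum>m\<in>degrees a b. x ^ m (Inl 1) * y ^ m (Inl 3) * z ^ m (Inr 1) * w ^ m (Inr 3))"
    by (rule sum.reindex_bij_witness[where
          i = "\<lambda>m. ((m (Inl 1), m (Inl 3)), (m (Inr 1), m (Inr 3)))" and
          j = "\<lambda>r. monom6 (fst (fst r)) (a - fst (fst r) - snd (fst r)) (snd (fst r))
             (fst (snd r)) (b - fst (snd r) - snd (snd r)) (snd (snd r))"])
      (auto simp: degrees_def degL_def degR_def mult_ac intro!: monom_ext)
  finally show ?thesis ..
qed

text \<open>The monomials divisible by \<open>x\<^sub>2 y\<^sub>2\<close> are a copy of the monomials of bidegree \<open>(a - 1, b - 1)\<close>, with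
  the same weights.\<close>

lemma sum_reduced:
  fixes x y z w :: complex
  shows "(\<Sum>m\<in>reduced_set a b. x ^ m (Inl 1) * y ^ m (Inl 3) * z ^ m (Inr 1) * w ^ m (Inr 3))
    = triangle_sum x y a * triangle_sum z w b
      - (if a = 0 \<or> b = 0 then 0 else triangle_sum x y (a - 1) * triangle_sum z w (b - 1))"
proof (cases "a = 0 \<or> b = 0")
  case True
  then have "reduced_set a b = degrees a b"
    by (auto simp: index_set_def degrees_def reduced_def degL_def degR_def)
  then show ?thesis using True by (simp add: sum_degrees)
next
  case False
  let ?f = "\<lambda>m::monom. x ^ m (Inl 1) * y ^ m (Inl 3) * z ^ m (Inr 1) * w ^ m (Inr 3)"
  let ?D = "degrees (a - 1) (b - 1)"
  have "degrees a b = reduced_set a b \<union> up 2 ` ?D"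
  proof (intro subset_antisym subsetI)
    fix m assume m: "m \<in> degrees a b"
    show "m \<in> reduced_set a b \<union> up 2 ` ?D"
    proof (cases "reduced m")
      case False
      then have "m = up 2 (down 2 m)" by (simp add: reduced_def up_down)
      moreover have "down 2 m \<in> ?D" using m False
        by (auto simp: degrees_def degL_def degR_def down_def reduced_def)
      ultimately show ?thesis by blast
    qed (use m in \<open>auto simp: index_set_def degrees_def\<close>)
  next
    fix m assume "m \<in> reduced_set a b \<union> up 2 ` ?D"
    then show "m \<in> degrees a b"
      using False by (auto simp: index_set_def degrees_def degL_def degR_def up_def)
  qed
  moreover have "reduced_set a b \<inter> up 2 ` ?D = {}"
    by (auto simp: index_set_def reduced_def up_def)
  ultimately have "sum ?f (degrees a b) = sum ?f (reduced_set a b) + sum ?f (up 2 ` ?D)"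
    by (simp add: sum.union_disjoint finite_index_set finite_deg)
  also have "sum ?f (up 2 ` ?D) = sum ?f ?D"
  proof (subst sum.reindex)
    show "inj_on (up 2) ?D" by (metis down_up inj_onI)
  qed (simp add: up_def)
  finally show ?thesis using False by (simp add: sum_degrees)
qed

lemma card_reduced: "2 * card (reduced_set a b) = (a + 1) * (b + 1) * (a + b + 2)"
proof -
  have "of_nat (card (reduced_set a b)) = (\<Sum>m\<in>reduced_set a b. 1 ^ m (Inl 1) * 1 ^ m (Inl 3) * 1 ^ m (Inr 1) * 1 ^ m (Inr 3) :: complex)"
    by simp
  also have "2 * \<dots> = of_nat ((a + 1) * (b + 1) * (a + b + 2))"
    unfolding sum_reduced triangle_sum_one
    by (cases a; cases b) (simp_all add: field_simps)
  finally have "(of_nat (2 * card (reduced_set a b)) :: complex) = of_nat ((a + 1) * (b + 1) * (a + b + 2))" by simp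
  then show ?thesis unfolding of_nat_eq_iff .
qed

text \<open>Modulo 3 this is the height of the weight, written without subtraction.\<close>

definition height3 :: "monom \<Rightarrow> nat" where
  "height3 m = m (Inl 1) + 2 * m (Inl 3) + 2 * m (Inr 1) + m (Inr 3)"

text \<open>For a primitive cube root of unity \<open>x\<close>, the sum of \<open>x\<close> to the power \<open>height3 m\<close> over the reduced
  monomials is the character of the module at an element of order three.  It equals 1 or -1 here, and
  comparing real and imaginary parts determines the number of monomials in each residue class.\<close>

lemma card_height3:
  assumes "a mod 3 = b mod 3"
  shows "a mod 3 = 0 \<Longrightarrow> 3 * card {m \<in> reduced_set a b. height3 m mod 3 = 1} + 1 = card (reduced_set a b)"
    and "a mod 3 = 1 \<Longrightarrow> 3 * card {m \<in> reduced_set a b. height3 m mod 3 = 1} = card (reduced_set a b) + 1"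
proof -
  define x where "x = Complex (-1/2) (sqrt 3 / 2)"
  have x: "1 + x + x^2 = 0"
    by (simp add: x_def complex_eq_iff power2_eq_square)
  have x3: "x ^ 3 = 1" by (rule cube_root_powers[OF x])
  have x4: "(x^2)^2 = x" using x3 by (simp add: numeral_eq_Suc)
  have y: "1 + x^2 + (x^2)^2 = 0" using x x4 by (simp add: add_ac)
  let ?N = "reduced_set a b"
  define c where "c r = card {m \<in> ?N. height3 m mod 3 = r}" for r
  have ev: "(\<Sum>m\<in>?N. f (height3 m mod 3)) = of_nat (c 0) * f 0 + of_nat (c 1) * f 1 + of_nat (c 2) * f 2"
    for f :: "nat \<Rightarrow> complex"
  proof -
    have "f (height3 m mod 3) = (if height3 m mod 3 = 0 then f 0 else 0) + (if height3 m mod 3 = 1 then f 1 else 0)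
       + (if height3 m mod 3 = 2 then f 2 else 0)" for m
    proof -
      have "height3 m mod 3 = 0 \<or> height3 m mod 3 = 1 \<or> height3 m mod 3 = 2" by auto
      then show ?thesis by auto
    qed
    then have "(\<Sum>m\<in>?N. f (height3 m mod 3)) = (\<Sum>m\<in>?N. (if height3 m mod 3 = 0 then f 0 else 0) + (if height3 m mod 3 = 1 then f 1 else 0)
       + (if height3 m mod 3 = 2 then f 2 else 0))" by (rule sum.cong[OF HOL.refl])
    then show ?thesis
      by (simp add: sum.distrib c_def finite_index_set sum.inter_filter[symmetric])
  qed
  have tot: "card ?N = c 0 + c 1 + c 2"
  proof -
    have "(of_nat (card ?N) :: complex) = of_nat (c 0 + c 1 + c 2)" using ev[of "\<lambda>_. 1"] by simp
    then show ?thesis unfolding of_nat_eq_iff .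
  qed
  have "x ^ m (Inl 1) * (x^2) ^ m (Inl 3) * (x^2) ^ m (Inr 1) * x ^ m (Inr 3) = x ^ (height3 m mod 3)" for m
  proof -
    have "x ^ height3 m = x ^ (3 * (height3 m div 3) + height3 m mod 3)" by simp
    also have "\<dots> = x ^ (height3 m mod 3)" unfolding power_add power_mult by (simp add: x3)
    finally show ?thesis by (simp add: height3_def power_add power_mult mult_ac)
  qed
  then have "(\<Sum>m\<in>?N. x ^ (height3 m mod 3)) = triangle_sum x (x^2) a * triangle_sum (x^2) x b
      - (if a = 0 \<or> b = 0 then 0 else triangle_sum x (x^2) (a - 1) * triangle_sum (x^2) x (b - 1))"
    using sum_reduced[of x "x^2" "x^2" x a b] by simp
  also have "\<dots> = (if 3 dvd a then 1 else 0) * (if 3 dvd b then 1 else 0)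
    - (if a = 0 \<or> b = 0 then 0 else (if 3 dvd (a - 1) then 1 else 0) * (if 3 dvd (b - 1) then 1 else 0))"
    using triangle_sum_cube_root[OF x] triangle_sum_cube_root[OF y] x4 by simp
  finally have S: "of_nat (c 0) + of_nat (c 1) * x + of_nat (c 2) * x^2
    = (if 3 dvd a then 1 else 0) * (if 3 dvd b then 1 else 0)
    - (if a = 0 \<or> b = 0 then 0 else (if 3 dvd (a - 1) then 1 else 0) * (if 3 dvd (b - 1) then 1 else 0))"
    using ev[of "\<lambda>r. x ^ r"] by simp
  have key: "real (c 1) = real (c 2) \<and> real (c 0) = e + real (c 1)"
    if "of_nat (c 0) + of_nat (c 1) * x + of_nat (c 2) * x^2 = of_real e" for e
  proof -
    have r: "Re x = -1/2" "Im x = sqrt 3 / 2" "Re (x^2) = -1/2" "Im (x^2) = - sqrt 3 / 2"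
      by (simp_all add: x_def power2_eq_square)
    have "Re (of_nat (c 0) + of_nat (c 1) * x + of_nat (c 2) * x^2) = e"
      "Im (of_nat (c 0) + of_nat (c 1) * x + of_nat (c 2) * x^2) = 0" using that by simp_all
    then have "real (c 0) - real (c 1) / 2 - real (c 2) / 2 = e" "sqrt 3 * (real (c 1) - real (c 2)) = 0"
      by (simp_all add: r algebra_simps del: of_nat_eq_iff)
    then show ?thesis by simp
  qed
  { assume "a mod 3 = 0"
    then have "3 dvd a" "3 dvd b" "\<not> (a \<noteq> 0 \<and> 3 dvd (a - 1))" using assms by presburger+
    then have "of_nat (c 0) + of_nat (c 1) * x + of_nat (c 2) * x^2 = of_real 1" using S by auto
    from key[OF this] have "3 * c 1 + 1 = card ?N" unfolding tot by linarith
    then show "3 * card {m \<in> ?N. height3 m mod 3 = 1} + 1 = card ?N" by (simp add: c_def) }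
  { assume "a mod 3 = 1"
    then have "\<not> 3 dvd a" "a \<noteq> 0" "b \<noteq> 0" "3 dvd (a - 1)" "3 dvd (b - 1)" using assms by presburger+
    then have "of_nat (c 0) + of_nat (c 1) * x + of_nat (c 2) * x^2 = of_real (-1)" using S by auto
    from key[OF this] have "3 * c 1 = card ?N + 1" unfolding tot by linarith
    then show "3 * card {m \<in> ?N. height3 m mod 3 = 1} = card ?N + 1" by (simp add: c_def) }
qed

section \<open>The Weyl group and cosets of the affine Weyl group\<close>

definition weight :: "int \<Rightarrow> int \<Rightarrow> real^3" where
  "weight p q = of_int p *\<^sub>R \<Lambda>1 + of_int q *\<^sub>R \<Lambda>2"

definition coords :: "real^3 \<Rightarrow> int \<times> int" where
  "coords v = (\<lfloor>v $ 1 - v $ 2\<rfloor>, \<lfloor>v $ 2 - v $ 3\<rfloor>)"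

lemma weight_components:
  "weight p q $ 1 = (2 * p + q) / 3" "weight p q $ 2 = (q - p) / 3" "weight p q $ 3 = - (p + 2 * q) / 3"
  by (simp_all add: weight_def \<Lambda>1_def \<Lambda>2_def field_simps)

lemma weight_diffs: "weight p q $ 1 - weight p q $ 2 = of_int p" "weight p q $ 2 - weight p q $ 3 = of_int q"
  by (simp_all add: weight_components field_simps)

lemma coords_weight [simp]: "coords (weight p q) = (p, q)"
  by (simp add: coords_def weight_diffs)

lemma weight_eqI: "v $ 1 = (2 * p + q) / 3 \<Longrightarrow> v $ 2 = (q - p) / 3 \<Longrightarrow> v $ 3 = - (p + 2 * q) / 3 \<Longrightarrow> v = weight p q"
  for p q :: int
  by (simp add: vec_eq_iff forall_3 weight_components)

lemma weight_linear: "weight p q + weight p' q' = weight (p + p') (q + q')"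
  "- weight p q = weight (-p) (-q)" "weight p q - weight p' q' = weight (p - p') (q - q')"
  by (simp_all add: vec_eq_iff forall_3 weight_components field_simps)

lemma weight_lattice_eq: "weight_lattice = {weight p q | p q. True}"
  by (simp add: weight_lattice_def weight_def)

lemma root_lattice_eq: "root_lattice = {v :: real^3. v$1 \<in> \<int> \<and> v$2 \<in> \<int> \<and> v$3 \<in> \<int> \<and> v$1 + v$2 + v$3 = 0}"
proof (intro subset_antisym subsetI)
  fix v :: "real^3" assume "v \<in> {v. v$1 \<in> \<int> \<and> v$2 \<in> \<int> \<and> v$3 \<in> \<int> \<and> v$1 + v$2 + v$3 = 0}"
  then obtain a b where ab: "v$1 = of_int a" "v$3 = of_int b" "v$1 + v$2 + v$3 = 0" by (auto elim!: Ints_cases)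
  then have "v = of_int a *\<^sub>R \<alpha>1 + of_int (- b) *\<^sub>R \<alpha>2"
    by (simp add: vec_eq_iff forall_3 \<alpha>1_def \<alpha>2_def)
  then show "v \<in> root_lattice" unfolding root_lattice_def by blast
qed (auto simp: root_lattice_def \<alpha>1_def \<alpha>2_def)

lemma weight_root_lattice: "weight p q \<in> root_lattice \<longleftrightarrow> (p - q) mod 3 = 0"
proof
  assume "weight p q \<in> root_lattice"
  then obtain a b where "weight p q = of_int a *\<^sub>R \<alpha>1 + of_int b *\<^sub>R \<alpha>2" by (auto simp: root_lattice_def)
  then have "coords (weight p q) = coords (of_int a *\<^sub>R \<alpha>1 + of_int b *\<^sub>R \<alpha>2)" by simp
  moreover have "coords (of_int a *\<^sub>R \<alpha>1 + of_int b *\<^sub>R \<alpha>2) = (2 * a - b, 2 * b - a)"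
  proof -
    have "of_int a *\<^sub>R \<alpha>1 + of_int b *\<^sub>R \<alpha>2 = weight (2 * a - b) (2 * b - a)"
      by (rule weight_eqI) (simp_all add: \<alpha>1_def \<alpha>2_def field_simps)
    then show ?thesis by simp
  qed
  ultimately have "p - q = 3 * (a - b)" by simp
  then show "(p - q) mod 3 = 0" by simp
next
  assume "(p - q) mod 3 = 0"
  then obtain k where k: "p = q + 3 * k" by (metis add.commute diff_add_cancel mult_div_mod_eq add_0)
  have "weight p q = of_int (q + 2 * k) *\<^sub>R \<alpha>1 + of_int (q + k) *\<^sub>R \<alpha>2"
    by (simp add: vec_eq_iff forall_3 weight_components k \<alpha>1_def \<alpha>2_def field_simps)
  then show "weight p q \<in> root_lattice" unfolding root_lattice_def by blast
qed

definition permute :: "3 \<Rightarrow> 3 \<Rightarrow> 3 \<Rightarrow> real^3 \<Rightarrow> real^3" where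
  "permute i j k x = vector [x $ i, x $ j, x $ k]"

lemma permute_apply [simp]: "permute i j k x $ 1 = x $ i" "permute i j k x $ 2 = x $ j" "permute i j k x $ 3 = x $ k"
  by (simp_all add: permute_def)

lemma permute_id: "permute 1 2 3 = id"
  by (rule ext) (simp add: vec_eq_iff forall_3)

lemma reflections: "root_reflection \<alpha>1 = permute 2 1 3" "root_reflection \<alpha>2 = permute 1 3 2"
  by (rule ext; simp add: vec_eq_iff forall_3 root_reflection_def \<alpha>1_def \<alpha>2_def inner_vec_def sum_3 field_simps)+

lemma reflection_permute: "root_reflection \<alpha>1 \<circ> permute i j k = permute j i k"
  "root_reflection \<alpha>2 \<circ> permute i j k = permute i k j"
  by (rule ext; simp add: reflections vec_eq_iff forall_3)+

lemma finite_weyl_eq: "finite_weyl = {permute 1 2 3, permute 2 1 3, permute 1 3 2, permute 2 3 1, permute 3 1 2, permute 3 2 1}"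
proof (intro subset_antisym subsetI)
  fix w assume "w \<in> finite_weyl"
  then show "w \<in> {permute 1 2 3, permute 2 1 3, permute 1 3 2, permute 2 3 1, permute 3 1 2, permute 3 2 1}"
  proof induction
    case (refl w \<alpha>)
    then show ?case unfolding simple_roots_def
      by (elim insertE emptyE) (simp_all only: reflection_permute insert_iff simp_thms)
  qed (simp add: permute_id)
next
  have r1: "permute i j k \<in> finite_weyl \<Longrightarrow> permute j i k \<in> finite_weyl"
    and r2: "permute i j k \<in> finite_weyl \<Longrightarrow> permute i k j \<in> finite_weyl" for i j k
    using finite_weyl.refl[of "permute i j k" \<alpha>1] finite_weyl.refl[of "permute i j k" \<alpha>2]
    by (simp_all only: reflection_permute simple_roots_def insert_iff simp_thms)
  have "permute 1 2 3 \<in> finite_weyl" by (simp add: permute_id finite_weyl.id)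
  moreover note r1[OF this] r2[OF this] r2[OF r1[OF this]] r1[OF r2[OF this]] r1[OF r2[OF r1[OF this]]]
  moreover fix w assume "w \<in> {permute 1 2 3, permute 2 1 3, permute 1 3 2, permute 2 3 1, permute 3 1 2, permute 3 2 1}"
  ultimately show "w \<in> finite_weyl" by blast
qed

lemma inv_permute:
  "inv_into UNIV (permute 1 2 3) = permute 1 2 3" "inv_into UNIV (permute 2 1 3) = permute 2 1 3"
  "inv_into UNIV (permute 1 3 2) = permute 1 3 2" "inv_into UNIV (permute 2 3 1) = permute 3 1 2"
  "inv_into UNIV (permute 3 1 2) = permute 2 3 1" "inv_into UNIV (permute 3 2 1) = permute 3 2 1"
  by (rule inv_equality; simp add: vec_eq_iff forall_3)+

lemma finite_weyl_comp: "v \<in> finite_weyl \<Longrightarrow> w \<in> finite_weyl \<Longrightarrow> v \<circ> w \<in> finite_weyl"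
  by (induction rule: finite_weyl.induct) (simp_all add: comp_assoc finite_weyl.refl)

lemma finite_weyl_inv:
  assumes "w \<in> finite_weyl"
  shows "inv_into UNIV w \<in> finite_weyl" "inv_into UNIV w \<circ> w = id" "w \<circ> inv_into UNIV w = id"
proof -
  note cases = assms[unfolded finite_weyl_eq]
  show "inv_into UNIV w \<in> finite_weyl"
    using cases unfolding finite_weyl_eq
    by (elim insertE emptyE) (simp_all only: inv_permute insert_iff simp_thms)
  show "inv_into UNIV w \<circ> w = id"
    using cases by (elim insertE emptyE; intro ext) (simp_all add: inv_permute vec_eq_iff forall_3)
  show "w \<circ> inv_into UNIV w = id"
    using cases by (elim insertE emptyE; intro ext) (simp_all add: inv_permute vec_eq_iff forall_3)
qed

lemma finite_weyl_root_lattice: "w \<in> finite_weyl \<Longrightarrow> x \<in> root_lattice \<Longrightarrow> w x \<in> root_lattice"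
  unfolding finite_weyl_eq root_lattice_eq
  by (elim insertE emptyE) simp_all

lemma det_permute:
  "weyl_det (permute 1 2 3) = 1" "weyl_det (permute 2 1 3) = -1" "weyl_det (permute 1 3 2) = -1"
  "weyl_det (permute 2 3 1) = 1" "weyl_det (permute 3 1 2) = 1" "weyl_det (permute 3 2 1) = -1"
  by (simp_all add: weyl_det_def det_3 matrix_def axis_def)

lemma rho_components: "rho $ 1 = 1" "rho $ 2 = 0" "rho $ 3 = -1"
  by (simp_all add: rho_def \<Lambda>1_def \<Lambda>2_def)

text \<open>The coordinates of \<open>w\<^sup>-\<^sup>1 \<cdot> 0\<close>.\<close>

definition weyl_shift :: "(real^3 \<Rightarrow> real^3) \<Rightarrow> int \<times> int" where
  "weyl_shift w = coords (shifted_action (inv_into UNIV w) 0)"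

lemma weyl_shift_permute:
  "weyl_shift (permute 1 2 3) = (0, 0)" "weyl_shift (permute 2 1 3) = (-2, 1)"
  "weyl_shift (permute 1 3 2) = (1, -2)" "weyl_shift (permute 2 3 1) = (-3, 0)"
  "weyl_shift (permute 3 1 2) = (0, -3)" "weyl_shift (permute 3 2 1) = (-2, -2)"
  by (simp_all add: weyl_shift_def coords_def shifted_action_def inv_permute rho_components)

lemma weyl_shift_weight:
  assumes "w \<in> finite_weyl"
  shows "shifted_action (inv_into UNIV w) 0 = weight (fst (weyl_shift w)) (snd (weyl_shift w))"
  using assms unfolding finite_weyl_eq
  by (elim insertE emptyE)
    (simp_all add: shifted_action_def inv_permute weyl_shift_permute vec_eq_iff forall_3 rho_components weight_components)

lemma weyl_shift_inj: "inj_on weyl_shift finite_weyl"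
proof (rule inj_onI)
  fix v w assume "v \<in> finite_weyl" "w \<in> finite_weyl" "weyl_shift v = weyl_shift w"
  then show "v = w" unfolding finite_weyl_eq
    by (elim insertE emptyE) (simp_all add: weyl_shift_permute)
qed

lemma weyl_shift_image:
  "weyl_shift ` finite_weyl = {(0, 0), (-2, 1), (1, -2), (-3, 0), (0, -3), (-2, -2)}"
  by (simp only: finite_weyl_eq image_insert image_empty weyl_shift_permute)

lemma iota_weight:
  assumes "w \<in> finite_weyl"
  shows "iota (ext_elt w (weight x y)) = weight (3 * x + fst (weyl_shift w)) (3 * y + snd (weyl_shift w))"
proof -
  have "3 *\<^sub>R weight x y = weight (3 * x) (3 * y)"
    by (simp add: vec_eq_iff forall_3 weight_components)
  then show ?thesis
    unfolding iota_def ext_elt_def prod.case minus_minus weyl_shift_weight[OF assms] by (simp only: weight_linear)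
qed

text \<open>The affine Weyl group is normal and contains the finite one, so its coset of \<open>w t\<^bsub>-lam\<^esub>\<close> is determined
  by the class of \<open>lam\<close> modulo the root lattice.\<close>

lemma coset_eq:
  assumes w: "w \<in> finite_weyl"
  shows "affine_weyl #>\<^bsub>ext_affine_weyl\<^esub> ext_elt w (weight l1 l2)
    = {ext_elt u (weight x y) | u x y. u \<in> finite_weyl \<and> (x - y) mod 3 = (l1 - l2) mod 3}" (is "?L = ?R")
proof -
  have L: "?L = {(v \<circ> w, inv_into UNIV w \<beta> - weight l1 l2) | v \<beta>. v \<in> finite_weyl \<and> \<beta> \<in> root_lattice}"
    by (force simp: r_coset_def affine_weyl_def ext_affine_weyl_def ext_elt_def)
  have md: "weight l1 l2 - weight x y \<in> root_lattice \<longleftrightarrow> (x - y) mod 3 = (l1 - l2) mod 3" for x y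
  proof -
    have "weight l1 l2 - weight x y \<in> root_lattice \<longleftrightarrow> ((l1 - l2) - (x - y)) mod 3 = 0"
      by (simp add: weight_linear weight_root_lattice algebra_simps)
    then show ?thesis by presburger
  qed
  show ?thesis
  proof (intro subset_antisym subsetI)
    fix z assume "z \<in> ?L"
    then obtain v \<beta> where z: "z = (v \<circ> w, inv_into UNIV w \<beta> - weight l1 l2)" "v \<in> finite_weyl" "\<beta> \<in> root_lattice"
      unfolding L by blast
    let ?\<beta> = "inv_into UNIV w \<beta>"
    have \<beta>: "?\<beta> \<in> root_lattice" by (rule finite_weyl_root_lattice[OF finite_weyl_inv(1)[OF w] z(3)])
    have "root_lattice \<subseteq> weight_lattice"
    proof
      fix r assume "r \<in> root_lattice"
      then obtain a b where "r = of_int a *\<^sub>R \<alpha>1 + of_int b *\<^sub>R \<alpha>2" by (auto simp: root_lattice_def)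
      then have "r = weight (2 * a - b) (2 * b - a)"
        by (intro weight_eqI) (simp_all add: \<alpha>1_def \<alpha>2_def field_simps)
      then show "r \<in> weight_lattice" by (auto simp: weight_lattice_eq)
    qed
    then obtain p q where pq: "?\<beta> = weight p q" using \<beta> by (auto simp: weight_lattice_eq)
    have "z = ext_elt (v \<circ> w) (weight (l1 - p) (l2 - q))"
      by (simp add: z ext_elt_def pq weight_linear)
    moreover have "(l1 - p - (l2 - q)) mod 3 = (l1 - l2) mod 3"
      unfolding md[symmetric] using \<beta> by (simp add: pq weight_linear)
    ultimately show "z \<in> ?R" using finite_weyl_comp[OF z(2) w] by blast
  next
    fix z assume "z \<in> ?R"
    then obtain u x y where z: "z = ext_elt u (weight x y)" "u \<in> finite_weyl" "(x - y) mod 3 = (l1 - l2) mod 3"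
      by blast
    let ?\<beta> = "w (weight l1 l2 - weight x y)"
    have "?\<beta> \<in> root_lattice" using finite_weyl_root_lattice[OF w] z(3) md by blast
    moreover have "u \<circ> inv_into UNIV w \<in> finite_weyl"
      using finite_weyl_comp z(2) finite_weyl_inv(1)[OF w] by blast
    moreover have "u \<circ> inv_into UNIV w \<circ> w = u"
      using finite_weyl_inv(2)[OF w] by (simp only: comp_assoc comp_id)
    moreover have "inv_into UNIV w ?\<beta> - weight l1 l2 = - weight x y"
      using fun_cong[OF finite_weyl_inv(2)[OF w], of "weight l1 l2 - weight x y"] by simp
    ultimately show "z \<in> ?L" unfolding L unfolding z(1) ext_elt_def
      by (intro CollectI exI[of _ "u \<circ> inv_into UNIV w"] exI[of _ ?\<beta>] conjI) (simp_all only:)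
  qed
qed

text \<open>The union of the classes \<open>3P\<close> and \<open>3P - \<alpha>1\<close> in the root lattice; the third class, that of
  \<open>\<alpha>1 = 2 \<Lambda>1 - \<Lambda>2\<close>, has first coordinate 2 modulo 3.\<close>

definition good_coords :: "(int \<times> int) set" where
  "good_coords = {(p, q). (p - q) mod 3 = 0 \<and> p mod 3 \<noteq> 2}"

text \<open>The six shifts \<open>w\<^sup>-\<^sup>1 \<cdot> 0\<close> fall into two triples, by determinant: one in \<open>3P\<close> and the other in
  \<open>3P - \<alpha>1\<close>.  After division by 3 the members of each triple differ by weights that represent all three
  classes of \<open>P\<close> modulo \<open>Q\<close>.  So for every target exactly one \<open>w\<close> leads to a translation in the
  prescribed class.\<close>

lemma coset_bij:
  "bij_betw (\<lambda>z. coords (iota z))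
     {ext_elt u (weight x y) | u x y. u \<in> finite_weyl \<and> (x - y) mod 3 = c mod 3} good_coords"
    (is "bij_betw _ ?C _")
proof (rule bij_betw_imageI)
  let ?D = "{(0, 0), (-2, 1), (1, -2), (-3, 0), (0, -3), (-2, -2)} :: (int \<times> int) set"
  have D: "weyl_shift u \<in> ?D" if "u \<in> finite_weyl" for u using that weyl_shift_image by blast
  show "inj_on (\<lambda>z. coords (iota z)) ?C"
  proof (rule inj_onI)
    fix z z' assume "z \<in> ?C" "z' \<in> ?C" and eq: "coords (iota z) = coords (iota z')"
    then obtain u x y u' x' y' where
      z: "z = ext_elt u (weight x y)" "u \<in> finite_weyl" "(x - y) mod 3 = c mod 3"
      "z' = ext_elt u' (weight x' y')" "u' \<in> finite_weyl" "(x' - y') mod 3 = c mod 3" by blast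
    obtain d1 d2 e1 e2 where d: "weyl_shift u = (d1, d2)" "weyl_shift u' = (e1, e2)" by fastforce
    have eqs: "3 * x + d1 = 3 * x' + e1" "3 * y + d2 = 3 * y' + e2"
      using eq by (simp_all add: z iota_weight d)
    have "(x - y) mod 3 = (x' - y') mod 3" using z by simp
    then obtain k where "x' - y' = x - y + 3 * k" by (metis mod_eqE mult.commute add_diff_cancel_left' diff_add_cancel add.commute)
    then have k: "d1 - d2 = e1 - e2 + 9 * k" "d1 - e1 = 3 * (x' - x)"
      using eqs by (simp_all add: algebra_simps)
    have D2: "(d1, d2) \<in> ?D" "(e1, e2) \<in> ?D" using D[OF z(2)] D[OF z(5)] by (simp_all only: d)
    have "(d1, d2) = (e1, e2)"
    proof -
      \<comment> \<open>Among the six shifts, \<open>d1 - d2\<close> modulo 9 and \<open>d1\<close> modulo 3 together are distinct.\<close>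
      have "\<bar>(d1 - d2) - (e1 - e2)\<bar> < 9" using D2 by auto
      then have "d1 - d2 = e1 - e2" using k by simp
      moreover have "d1 = e1 \<or> (d1 - e1) mod 3 \<noteq> 0 \<or> d1 - d2 \<noteq> e1 - e2" using D2 by auto
      ultimately show ?thesis using k by simp
    qed
    then have "d1 = e1 \<and> d2 = e2 \<and> x = x' \<and> y = y'" using eqs by simp
    moreover from this have "u = u'" using inj_onD[OF weyl_shift_inj _ z(2,5)] d by simp
    ultimately show "z = z'" by (simp add: z)
  qed
  show "(\<lambda>z. coords (iota z)) ` ?C = good_coords"
  proof (intro subset_antisym subsetI)
    fix r assume "r \<in> (\<lambda>z. coords (iota z)) ` ?C"
    then obtain u x y where z: "r = coords (iota (ext_elt u (weight x y)))" "u \<in> finite_weyl" by blast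
    obtain d1 d2 where d: "weyl_shift u = (d1, d2)" by fastforce
    have "(d1, d2) \<in> ?D" using D[OF z(2)] by (simp only: d)
    then have "(3 * x + d1 - (3 * y + d2)) mod 3 = 0 \<and> (3 * x + d1) mod 3 \<noteq> 2"
      by (elim insertE emptyE; simp only: prod.inject; presburger)
    then show "r \<in> good_coords" by (simp add: z iota_weight d good_coords_def)
  next
    fix r assume "r \<in> good_coords"
    then obtain p q where r: "r = (p, q)" "(p - q) mod 3 = 0" "p mod 3 \<noteq> 2" by (auto simp: good_coords_def)
    have "\<exists>d1 d2 x y. (d1, d2) \<in> ?D \<and> p = 3 * x + d1 \<and> q = 3 * y + d2 \<and> (x - y) mod 3 = c mod 3"
    proof -
      have three: "t mod 3 = c mod 3 \<or> (t + 1) mod 3 = c mod 3 \<or> (t - 1) mod 3 = c mod 3" for t :: int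
      proof -
        have "t mod 3 = 0 \<or> t mod 3 = 1 \<or> t mod 3 = 2" "c mod 3 = 0 \<or> c mod 3 = 1 \<or> c mod 3 = 2"
          by presburger+
        moreover have "(t + 1) mod 3 = (t mod 3 + 1) mod 3" "(t - 1) mod 3 = (t mod 3 - 1) mod 3"
          by (simp_all only: mod_add_left_eq mod_diff_left_eq)
        ultimately show ?thesis by (elim disjE) simp_all
      qed
      define P Q where "P = p div 3" and "Q = q div 3"
      have "(p = 3 * P \<and> q = 3 * Q) \<or> (p = 3 * P + 1 \<and> q = 3 * Q + 1)"
        using r(2,3) unfolding P_def Q_def by presburger
      then consider "p = 3 * P" "q = 3 * Q" | "p = 3 * P + 1" "q = 3 * Q + 1" by blast
      \<comment> \<open>Both cases choose the shift for which \<open>x - y\<close> gets the right residue.\<close>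
      then show ?thesis
      proof cases
        case 1
        have "(P - Q) mod 3 = c mod 3 \<or> (P + 1 - Q) mod 3 = c mod 3 \<or> (P - (Q + 1)) mod 3 = c mod 3"
          using three[of "P - Q"] by (simp add: algebra_simps)
        then consider "(P - Q) mod 3 = c mod 3" | "(P + 1 - Q) mod 3 = c mod 3" | "(P - (Q + 1)) mod 3 = c mod 3"
          by blast
        then show ?thesis
        proof cases
          case a: 1
          then show ?thesis using 1 by (intro exI[of _ 0] exI[of _ 0] exI[of _ P] exI[of _ Q]) simp
        next
          case a: 2
          then show ?thesis using 1
            by (intro exI[of _ "-3"] exI[of _ 0] exI[of _ "P + 1"] exI[of _ Q]) simp
        next
          case a: 3
          then show ?thesis using 1
            by (intro exI[of _ 0] exI[of _ "-3"] exI[of _ P] exI[of _ "Q + 1"]) simp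
        qed
      next
        case 2
        have "(P + 1 - Q) mod 3 = c mod 3 \<or> (P - (Q + 1)) mod 3 = c mod 3 \<or> (P + 1 - (Q + 1)) mod 3 = c mod 3"
          using three[of "P - Q"] by (auto simp: algebra_simps)
        then consider "(P + 1 - Q) mod 3 = c mod 3" | "(P - (Q + 1)) mod 3 = c mod 3" | "(P + 1 - (Q + 1)) mod 3 = c mod 3"
          by blast
        then show ?thesis
        proof cases
          case a: 1
          then show ?thesis using 2
            by (intro exI[of _ "-2"] exI[of _ 1] exI[of _ "P + 1"] exI[of _ Q]) simp
        next
          case a: 2
          then show ?thesis using 2
            by (intro exI[of _ 1] exI[of _ "-2"] exI[of _ P] exI[of _ "Q + 1"]) simp
        next
          case a: 3
          then show ?thesis using 2
            by (intro exI[of _ "-2"] exI[of _ "-2"] exI[of _ "P + 1"] exI[of _ "Q + 1"]) simp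
        qed
      qed
    qed
    then obtain d1 d2 x y where d: "(d1, d2) \<in> ?D" "p = 3 * x + d1" "q = 3 * y + d2" "(x - y) mod 3 = c mod 3"
      by blast
    then obtain u where u: "u \<in> finite_weyl" "weyl_shift u = (d1, d2)" using weyl_shift_image by (metis imageE)
    then have "r = coords (iota (ext_elt u (weight x y)))" by (simp add: iota_weight r d)
    moreover have "ext_elt u (weight x y) \<in> ?C" using u(1) d(4) by blast
    ultimately show "r \<in> (\<lambda>z. coords (iota z)) ` ?C" by (rule image_eqI)
  qed
qed

section \<open>The dimension formula\<close>

definition weight_coords :: "monom \<Rightarrow> int \<times> int" where
  "weight_coords m = (wt 1 m - wt 2 m, wt 2 m - wt 3 m)"

text \<open>For \<open>a\<close> congruent to \<open>b\<close> all weights lie in the root lattice, and there the first fundamental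
  coordinate is twice the height modulo 3.\<close>

lemma good_coords_height:
  assumes "a mod 3 = b mod 3" "m \<in> reduced_set a b"
  shows "weight_coords m \<in> good_coords \<longleftrightarrow> height3 m mod 3 \<noteq> 1"
proof -
  have "degL m = a" "degR m = b" using assms(2) by (auto simp: index_set_def)
  then obtain k where k: "int (degL m) = int (degR m) + 3 * k"
    using assms(1) by (metis (no_types, opaque_lifting) add.commute mod_eqE nat_int_comparison(1) of_nat_mod of_nat_numeral)
  let ?x1 = "int (m (Inl 1))" and ?x2 = "int (m (Inl 2))" and ?x3 = "int (m (Inl 3))"
  let ?y1 = "int (m (Inr 1))" and ?y2 = "int (m (Inr 2))" and ?y3 = "int (m (Inr 3))"
  have s: "?x1 + ?x2 + ?x3 = ?y1 + ?y2 + ?y3 + 3 * k" using k by (simp add: degL_def degR_def)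
  have h: "height3 m mod 3 = 1 \<longleftrightarrow> (?x1 + 2 * ?x3 + 2 * ?y1 + ?y3) mod 3 = 1"
    unfolding height3_def by presburger
  have "(wt 1 m - wt 2 m) - (wt 2 m - wt 3 m) = 3 * (k - wt 2 m)"
    using s by (simp add: wt_def)
  then have 1: "((wt 1 m - wt 2 m) - (wt 2 m - wt 3 m)) mod 3 = 0" by (simp only: mod_mult_self1_is_0)
  have double: "n mod 3 = 2 \<longleftrightarrow> e mod 3 = 1" if "n = 2 * e - 3 * f" for n e f :: int
    using that by presburger
  have "wt 1 m - wt 2 m = 2 * (?x1 + 2 * ?x3 + 2 * ?y1 + ?y3) - 3 * (k + ?x3 + 2 * ?y1 + ?y3)"
    using s by (simp add: wt_def)
  then have "(wt 1 m - wt 2 m) mod 3 = 2 \<longleftrightarrow> (?x1 + 2 * ?x3 + 2 * ?y1 + ?y3) mod 3 = 1" by (rule double)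
  then show ?thesis using 1 h by (simp add: weight_coords_def good_coords_def)
qed

lemma gen_dim_count:
  assumes w: "w \<in> finite_weyl" and dom: "iota (ext_elt w (weight l1 l2)) = weight (int a) (int b)"
    and ab: "a mod 3 = b mod 3"
  shows "gen_dim (ext_elt w (weight l1 l2)) = card {m \<in> reduced_set a b. height3 m mod 3 \<noteq> 1}"
proof -
  let ?y = "ext_elt w (weight l1 l2)" and ?N = "reduced_set a b"
  let ?C = "{ext_elt u (weight x y) | u x y. u \<in> finite_weyl \<and> (x - y) mod 3 = (l1 - l2) mod 3}"
  define M where "M r = card {m \<in> ?N. weight_coords m = r}" for r
  have C: "affine_weyl #>\<^bsub>ext_affine_weyl\<^esub> ?y = ?C" by (rule coset_eq[OF w])
  have mult: "gen_mult ?y z = M (coords (iota z))" if "z \<in> ?C" for z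
  proof -
    from that obtain u x y where z: "z = ext_elt u (weight x y)" "u \<in> finite_weyl" by blast
    then obtain p q where pq: "iota z = weight p q" using iota_weight by blast
    have "weight_mult (iota ?y) (iota z) = card (index_set a b (\<lambda>x y. x = p \<and> y = q))"
      unfolding dom pq by (rule irr_module_dimensions(2)) (simp_all add: weight_diffs)
    moreover have "index_set a b (\<lambda>x y. x = p \<and> y = q) = {m \<in> ?N. weight_coords m = (p, q)}"
      by (auto simp: index_set_def weight_coords_def)
    ultimately show ?thesis using that by (simp only: gen_mult_def C if_True M_def pq coords_weight)
  qed
  have Csub: "?C \<subseteq> carrier ext_affine_weyl"
    by (auto simp: ext_affine_weyl_def ext_elt_def weight_lattice_eq weight_linear)
  have "gen_dim ?y = (\<Sum>\<^sub>\<infinity>z\<in>?C. M (coords (iota z)))"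
    unfolding gen_dim_def
    by (rule infsum_cong_neutral) (use Csub mult in \<open>auto simp: gen_mult_def C simp del: mem_Collect_eq\<close>)
  also have "\<dots> = (\<Sum>\<^sub>\<infinity>r\<in>good_coords. M r)"
    by (rule infsum_reindex_bij_betw[OF coset_bij])
  also have "\<dots> = (\<Sum>\<^sub>\<infinity>r\<in>weight_coords ` {m \<in> ?N. weight_coords m \<in> good_coords}. M r)"
  proof (rule infsum_cong_neutral)
    fix r assume "r \<in> good_coords - weight_coords ` {m \<in> ?N. weight_coords m \<in> good_coords}"
    then have "{m \<in> ?N. weight_coords m = r} = {}" by auto
    then show "M r = 0" unfolding M_def by (simp only: card.empty)
  qed auto
  also have "\<dots> = (\<Sum>r\<in>weight_coords ` {m \<in> ?N. weight_coords m \<in> good_coords}. M r)"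
    by (rule infsum_finite) (simp add: finite_index_set)
  also have "\<dots> = (\<Sum>r\<in>weight_coords ` {m \<in> ?N. weight_coords m \<in> good_coords}.
      \<Sum>m | m \<in> {m \<in> ?N. weight_coords m \<in> good_coords} \<and> weight_coords m = r. 1)"
  proof (rule sum.cong[OF HOL.refl])
    fix r assume r: "r \<in> weight_coords ` {m \<in> ?N. weight_coords m \<in> good_coords}"
    then have "{m \<in> ?N. weight_coords m = r}
      = {m. m \<in> {m \<in> ?N. weight_coords m \<in> good_coords} \<and> weight_coords m = r}" by auto
    then show "M r = (\<Sum>m | m \<in> {m \<in> ?N. weight_coords m \<in> good_coords} \<and> weight_coords m = r. 1)"
      unfolding M_def by (simp only: card_eq_sum)
  qed
  also have "\<dots> = (\<Sum>m\<in>{m \<in> ?N. weight_coords m \<in> good_coords}. 1)"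
    by (rule sum.group) (simp_all add: finite_index_set)
  also have "\<dots> = card {m \<in> ?N. weight_coords m \<in> good_coords}" by simp
  also have "{m \<in> ?N. weight_coords m \<in> good_coords} = {m \<in> ?N. height3 m mod 3 \<noteq> 1}"
    using good_coords_height[OF ab] by blast
  finally show ?thesis .
qed

lemma gen_dim_formula:
  assumes w: "w \<in> finite_weyl" and dom: "iota (ext_elt w (weight l1 l2)) = weight (int a) (int b)"
    and ab: "a mod 3 = b mod 3"
    and det: "(a mod 3 = 0 \<and> weyl_det w = 1) \<or> (a mod 3 = 1 \<and> weyl_det w = -1)"
  shows "real (gen_dim (ext_elt w (weight l1 l2))) =
    2/3 * real (irr_dim (iota (ext_elt w (weight l1 l2)))) + weyl_det w / 3"
proof -
  let ?N = "reduced_set a b"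
  have D: "irr_dim (iota (ext_elt w (weight l1 l2))) = card ?N"
    unfolding dom by (rule irr_module_dimensions(1)) (simp_all add: weight_diffs)
  have "card ?N = card {m \<in> ?N. height3 m mod 3 = 1} + card {m \<in> ?N. height3 m mod 3 \<noteq> 1}"
    by (subst card_Un_disjoint[symmetric]) (auto simp: finite_index_set intro!: arg_cong[where f=card])
  moreover have "(3 * real (card {m \<in> ?N. height3 m mod 3 = 1}) + weyl_det w = real (card ?N))"
    using det
  proof (elim disjE conjE)
    assume "a mod 3 = 0" "weyl_det w = 1"
    then show ?thesis using arg_cong[OF card_height3(1)[OF ab], of real] by linarith
  next
    assume "a mod 3 = 1" "weyl_det w = -1"
    then show ?thesis using arg_cong[OF card_height3(2)[OF ab], of real] by linarith
  qed
  ultimately show ?thesis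
    unfolding D gen_dim_count[OF w dom ab] by linarith
qed

lemma pos_roots_prod: "(\<Prod>\<alpha>\<in>pos_roots. f \<alpha>) = f \<alpha>1 * f \<alpha>2 * f (\<alpha>1 + \<alpha>2)" for f :: "real^3 \<Rightarrow> real"
proof -
  have "\<alpha>1 \<noteq> \<alpha>2" "\<alpha>1 \<noteq> \<alpha>1 + \<alpha>2" "\<alpha>2 \<noteq> \<alpha>1 + \<alpha>2"
    by (simp_all add: vec_eq_iff forall_3 \<alpha>1_def \<alpha>2_def)
  then show ?thesis by (simp add: pos_roots_def mult.assoc)
qed

lemma root_pairings: "x \<bullet> \<alpha>1 = x $ 1 - x $ 2" "x \<bullet> \<alpha>2 = x $ 2 - x $ 3"
  "x \<bullet> (\<alpha>1 + \<alpha>2) = x $ 1 - x $ 3"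
  by (simp_all add: inner_vec_def sum_3 \<alpha>1_def \<alpha>2_def)

text \<open>The positivity conditions in \<open>ext_weyl_plus\<close> are those that keep \<open>iota\<close> dominant: where the shift
  \<open>w\<^sup>-\<^sup>1 \<cdot> 0\<close> has a negative coordinate, at least -3, \<open>w\<close> sends the corresponding simple root to a negative one.\<close>

lemma plus_iota:
  assumes "ext_elt w (weight l1 l2) \<in> ext_weyl_plus"
  obtains a b where "w \<in> finite_weyl" "iota (ext_elt w (weight l1 l2)) = weight (int a) (int b)"
    "a mod 3 = b mod 3" "(a mod 3 = 0 \<and> weyl_det w = 1) \<or> (a mod 3 = 1 \<and> weyl_det w = -1)"
proof -
  have w: "w \<in> finite_weyl" and l: "weight l1 l2 \<bullet> \<alpha>1 \<ge> 0" "weight l1 l2 \<bullet> \<alpha>2 \<ge> 0"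
    and n1: "w \<alpha>1 \<in> neg_roots \<longrightarrow> weight l1 l2 \<bullet> \<alpha>1 > 0" and n2: "w \<alpha>2 \<in> neg_roots \<longrightarrow> weight l1 l2 \<bullet> \<alpha>2 > 0"
    using assms by (auto simp: ext_weyl_plus_def ext_elt_def dominant_weights_def simple_roots_def)
  have l': "l1 \<ge> 0" "l2 \<ge> 0" using l by (simp_all add: root_pairings weight_diffs)
  have m1: "w \<alpha>1 \<in> neg_roots \<Longrightarrow> l1 > 0" and m2: "w \<alpha>2 \<in> neg_roots \<Longrightarrow> l2 > 0"
    using n1 n2 by (simp_all add: root_pairings weight_diffs)
  have neg: "v \<in> neg_roots \<longleftrightarrow> v = - \<alpha>1 \<or> v = - \<alpha>2 \<or> v = - (\<alpha>1 + \<alpha>2)" for v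
    by (auto simp: neg_roots_def pos_roots_def)
  have facts: "fst (weyl_shift w) + 3 * l1 \<ge> 0 \<and> snd (weyl_shift w) + 3 * l2 \<ge> 0 \<and>
    (fst (weyl_shift w) - snd (weyl_shift w)) mod 3 = 0 \<and>
    ((fst (weyl_shift w) mod 3 = 0 \<and> weyl_det w = 1) \<or> (fst (weyl_shift w) mod 3 = 1 \<and> weyl_det w = -1))"
  proof -
    have n: "permute 2 1 3 \<alpha>1 \<in> neg_roots" "permute 1 3 2 \<alpha>2 \<in> neg_roots" "permute 2 3 1 \<alpha>1 \<in> neg_roots"
      "permute 3 1 2 \<alpha>2 \<in> neg_roots" "permute 3 2 1 \<alpha>1 \<in> neg_roots" "permute 3 2 1 \<alpha>2 \<in> neg_roots"
      unfolding neg by (simp_all add: vec_eq_iff forall_3 \<alpha>1_def \<alpha>2_def)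
    consider "w = permute 1 2 3" | "w = permute 2 1 3" "l1 > 0" | "w = permute 1 3 2" "l2 > 0"
      | "w = permute 2 3 1" "l1 > 0" | "w = permute 3 1 2" "l2 > 0" | "w = permute 3 2 1" "l1 > 0" "l2 > 0"
      using w n m1 m2 unfolding finite_weyl_eq by blast
    then show ?thesis
      by cases (use l' in \<open>simp_all add: weyl_shift_permute det_permute\<close>)
  qed
  define p q where "p = 3 * l1 + fst (weyl_shift w)" and "q = 3 * l2 + snd (weyl_shift w)"
  have "p \<ge> 0" "q \<ge> 0" using facts by (simp_all add: p_def q_def)
  then obtain a b where ab: "p = int a" "q = int b" by (metis nonneg_int_cases)
  have "iota (ext_elt w (weight l1 l2)) = weight (int a) (int b)"
    using iota_weight[OF w, of l1 l2] by (simp only: p_def[symmetric] q_def[symmetric] ab)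
  moreover have d: "(fst (weyl_shift w) - snd (weyl_shift w)) mod 3 = 0" using facts by blast
  have "(int a - int b) mod 3 = 0"
    using d unfolding ab[symmetric] p_def q_def by presburger
  then have "a mod 3 = b mod 3" by presburger
  moreover have r: "int (a mod 3) = fst (weyl_shift w) mod 3"
    unfolding of_nat_mod ab[symmetric] p_def by simp
  then have "(a mod 3 = 0 \<and> weyl_det w = 1) \<or> (a mod 3 = 1 \<and> weyl_det w = -1)"
    using facts by (elim conjE disjE) simp_all
  ultimately show thesis by (rule that[OF w])
qed

text \<open>The left side is \<open>\<langle>lam + w\<^sup>-\<^sup>1 rho / 3, \<alpha>\<rangle>\<close> because \<open>w\<close> is orthogonal.\<close>

lemma pairing_iota:
  assumes w: "w \<in> finite_weyl"
  shows "(w (weight l1 l2) + (1/3) *\<^sub>R rho) \<bullet> w \<alpha> = (1/3) * ((iota (ext_elt w (weight l1 l2)) + rho) \<bullet> \<alpha>)"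
proof -
  have iota: "iota (ext_elt w (weight l1 l2)) + rho = 3 *\<^sub>R weight l1 l2 + inv_into UNIV w rho"
    by (simp add: iota_def ext_elt_def shifted_action_def)
  show ?thesis
    using w unfolding iota finite_weyl_eq
    by (elim insertE emptyE) (simp_all add: inv_permute inner_vec_def sum_3 rho_components algebra_simps)
qed

theorem mainTheorem4:
  fixes w :: "real^3 \<Rightarrow> real^3" and lam :: "real^3"
  assumes "w \<in> finite_weyl" and "lam \<in> weight_lattice"
    and "ext_elt w lam \<in> ext_weyl_plus"
  shows "real (gen_dim (ext_elt w lam)) =
           9 * (\<Prod>\<alpha>\<in>pos_roots. (w lam + (1/3) *\<^sub>R rho) \<bullet> w \<alpha>) + weyl_det w / 3
       \<and> 9 * (\<Prod>\<alpha>\<in>pos_roots. (w lam + (1/3) *\<^sub>R rho) \<bullet> w \<alpha>) + weyl_det w / 3 =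
           1/3 * (\<Prod>\<alpha>\<in>pos_roots. (iota (ext_elt w lam) + rho) \<bullet> \<alpha>) + weyl_det w / 3
       \<and> 1/3 * (\<Prod>\<alpha>\<in>pos_roots. (iota (ext_elt w lam) + rho) \<bullet> \<alpha>) + weyl_det w / 3 =
           2/3 * real (irr_dim (iota (ext_elt w lam))) + weyl_det w / 3"
proof -
  obtain l1 l2 where lam: "lam = weight l1 l2" using assms(2) by (auto simp: weight_lattice_eq)
  obtain a b where ab: "iota (ext_elt w lam) = weight (int a) (int b)" "a mod 3 = b mod 3"
      "(a mod 3 = 0 \<and> weyl_det w = 1) \<or> (a mod 3 = 1 \<and> weyl_det w = -1)"
    using plus_iota[OF assms(3)[unfolded lam]] unfolding lam by metis
  have dim: "real (gen_dim (ext_elt w lam)) = 2/3 * real (irr_dim (iota (ext_elt w lam))) + weyl_det w / 3"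
    unfolding lam by (rule gen_dim_formula[OF assms(1) ab[unfolded lam]])
  have prod1: "9 * (\<Prod>\<alpha>\<in>pos_roots. (w lam + (1/3) *\<^sub>R rho) \<bullet> w \<alpha>)
      = 1/3 * (\<Prod>\<alpha>\<in>pos_roots. (iota (ext_elt w lam) + rho) \<bullet> \<alpha>)"
    unfolding lam pos_roots_prod pairing_iota[OF assms(1)] by simp
  have "irr_dim (iota (ext_elt w lam)) = card (reduced_set a b)"
    unfolding ab(1) by (rule irr_module_dimensions(1)) (simp_all add: weight_diffs)
  then have "2 * irr_dim (iota (ext_elt w lam)) = (a + 1) * (b + 1) * (a + b + 2)"
    by (simp only: card_reduced)
  then have "2 * real (irr_dim (iota (ext_elt w lam))) = (real a + 1) * (real b + 1) * (real a + real b + 2)"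
    by (metis (no_types, opaque_lifting) of_nat_1 of_nat_add of_nat_mult of_nat_numeral)
  moreover have "(\<Prod>\<alpha>\<in>pos_roots. (weight (int a) (int b) + rho) \<bullet> \<alpha>) = (real a + 1) * (real b + 1) * (real a + real b + 2)"
    unfolding pos_roots_prod by (simp add: root_pairings rho_components weight_components field_simps)
  ultimately have "1/3 * (\<Prod>\<alpha>\<in>pos_roots. (iota (ext_elt w lam) + rho) \<bullet> \<alpha>) = 2/3 * real (irr_dim (iota (ext_elt w lam)))"
    unfolding ab(1) by linarith
  with prod1 dim show ?thesis by linarith
qed

end
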